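(* Let $(M,g)$ be a Riemannian manifold, let $B$ be a domain (a connected open subset) in $M$, let $K$ be a compact subset of $B$, and let $W$ be a nonempty open subset of $B\setminus K$. Then there exists a nonnegative $C^\infty$ function $\alpha$ on $M$ such that $\alpha\equiv 0$ on $M\setminus B$, $\alpha>0$ and $\Delta_g\alpha>0$ on $K$, and $\Delta_g\alpha\ge 0$ on $M\setminus W$.
   Context: For a Riemannian manifold $(M,g)$ of dimension $n$, the Laplace operator is given in local coordinates by $$\Delta_g\varphi=\frac{1}{\sqrt G}\sum_{i,j=1}^n\frac{\partial}{\partial x_i}\Bigl[g^{ij}\sqrt G\,\frac{\partial\varphi}{\partial x_j}\Bigr],$$ where $G=\det(g_{ij})$ and $(g^{ij})=(g_{ij})^{-1}$. *)

theory Defs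
  imports "HOL-Analysis.Analysis"
begin

definition partial_deriv :: "'n::finite \<Rightarrow> (real^'n \<Rightarrow> real) \<Rightarrow> real^'n \<Rightarrow> real" where
  "partial_deriv i f x = deriv (\<lambda>t. f (x + t *\<^sub>R axis i 1)) 0"

text \<open>The following two notions are meant for open sets \<open>S\<close>.\<close>

primrec Ck_on :: "nat \<Rightarrow> (real^'n::finite) set \<Rightarrow> (real^'n \<Rightarrow> real) \<Rightarrow> bool" where
  "Ck_on 0 S f \<longleftrightarrow> continuous_on S f"
| "Ck_on (Suc k) S f \<longleftrightarrow> f differentiable_on S \<and> (\<forall>i. Ck_on k S (partial_deriv i f))"

definition smooth_on :: "(real^'n::finite) set \<Rightarrow> (real^'n \<Rightarrow> real) \<Rightarrow> bool" where
  "smooth_on S f \<longleftrightarrow> (\<forall>k. Ck_on k S f)"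

text \<open>
  A manifold is a whole type \<open>'m\<close>, whose topology is Hausdorff and second countable, together
  with a smooth atlas, which need not be maximal. A chart is a pair of its domain and its
  coordinate map; the values of the coordinate map off the domain are irrelevant.
\<close>

type_synonym ('m, 'n) chart = "'m set \<times> ('m \<Rightarrow> real^'n)"

definition chart_image :: "('m, 'n::finite) chart \<Rightarrow> (real^'n) set" where
  "chart_image c = snd c ` fst c"

definition chart_inv :: "('m, 'n::finite) chart \<Rightarrow> real^'n \<Rightarrow> 'm" where
  "chart_inv c = inv_into (fst c) (snd c)"

definition smooth_atlas ::
    "('m::{t2_space, second_countable_topology}, 'n::finite) chart set \<Rightarrow> bool" where
  "smooth_atlas A \<longleftrightarrow>
     (\<Union>c\<in>A. fst c) = UNIV \<and>
     (\<forall>c\<in>A. open (fst c) \<and> open (chart_image c) \<and>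
        homeomorphism (fst c) (chart_image c) (snd c) (chart_inv c)) \<and>
     (\<forall>c\<in>A. \<forall>d\<in>A. \<forall>i.
        smooth_on (snd c ` (fst c \<inter> fst d)) (\<lambda>x. snd d (chart_inv c x) $ i))"

definition smooth_fun ::
    "('m, 'n::finite) chart set \<Rightarrow> ('m \<Rightarrow> real) \<Rightarrow> bool" where
  "smooth_fun A f \<longleftrightarrow> (\<forall>c\<in>A. smooth_on (chart_image c) (f \<circ> chart_inv c))"

text \<open>
  Tangent vectors at \<open>p\<close> are the derivations at \<open>p\<close> of the algebra of smooth functions on the
  manifold. They are extended by \<open>0\<close> to the functions that are not smooth, so that two of them
  are equal as soon as they agree on the smooth functions.
\<close>

type_synonym 'm tangent_vector = "('m \<Rightarrow> real) \<Rightarrow> real"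

definition tangent_space ::
    "('m, 'n::finite) chart set \<Rightarrow> 'm \<Rightarrow> 'm tangent_vector set" where
  "tangent_space A p = {X.
     (\<forall>f h a b. smooth_fun A f \<longrightarrow> smooth_fun A h \<longrightarrow>
        X (\<lambda>q. a * f q + b * h q) = a * X f + b * X h) \<and>
     (\<forall>f h. smooth_fun A f \<longrightarrow> smooth_fun A h \<longrightarrow>
        X (\<lambda>q. f q * h q) = X f * h p + f p * X h) \<and>
     (\<forall>f. \<not> smooth_fun A f \<longrightarrow> X f = 0)}"

definition coord_vector ::
    "('m, 'n::finite) chart set \<Rightarrow> ('m, 'n) chart \<Rightarrow> 'n \<Rightarrow> 'm \<Rightarrow> 'm tangent_vector" where
  "coord_vector A c i p =
     (\<lambda>f. if smooth_fun A f then partial_deriv i (f \<circ> chart_inv c) (snd c p) else 0)"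

text \<open>
  A metric gives a form on the tangent space at each point; its values on functionals that are
  not tangent vectors are irrelevant.
\<close>

type_synonym 'm metric_tensor = "'m \<Rightarrow> 'm tangent_vector \<Rightarrow> 'm tangent_vector \<Rightarrow> real"

definition metric_matrix ::
    "('m, 'n::finite) chart set \<Rightarrow> 'm metric_tensor \<Rightarrow> ('m, 'n) chart \<Rightarrow> real^'n \<Rightarrow> real^'n^'n" where
  "metric_matrix A g c x = (\<chi> i j.
     let p = chart_inv c x in g p (coord_vector A c i p) (coord_vector A c j p))"

definition riemannian_metric ::
    "('m, 'n::finite) chart set \<Rightarrow> 'm metric_tensor \<Rightarrow> bool" where
  "riemannian_metric A g \<longleftrightarrow>
     (\<forall>p. \<forall>X \<in> tangent_space A p. \<forall>Y \<in> tangent_space A p. g p X Y = g p Y X) \<and>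
     (\<forall>p. \<forall>X \<in> tangent_space A p. \<forall>Y \<in> tangent_space A p. \<forall>Z \<in> tangent_space A p. \<forall>a b.
        g p (\<lambda>f. a * X f + b * Y f) Z = a * g p X Z + b * g p Y Z) \<and>
     (\<forall>p. \<forall>X \<in> tangent_space A p. X \<noteq> (\<lambda>f. 0) \<longrightarrow> g p X X > 0) \<and>
     (\<forall>c\<in>A. \<forall>i j. smooth_on (chart_image c) (\<lambda>x. metric_matrix A g c x $ i $ j))"

definition riemannian_manifold ::
    "('m::{t2_space, second_countable_topology}, 'n::finite) chart set \<Rightarrow> 'm metric_tensor \<Rightarrow> bool"
  where
  "riemannian_manifold A g \<longleftrightarrow> smooth_atlas A \<and> riemannian_metric A g"

text \<open>The Laplacian of \<open>f\<close> at \<open>p\<close>, computed in the local coordinates of a chart \<open>c\<close> around \<open>p\<close>.\<close>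

definition laplacian ::
    "('m, 'n::finite) chart set \<Rightarrow> 'm metric_tensor \<Rightarrow> ('m, 'n) chart \<Rightarrow> ('m \<Rightarrow> real) \<Rightarrow> 'm \<Rightarrow> real"
  where
  "laplacian A g c f p =
     (let G = (\<lambda>x. det (metric_matrix A g c x));
          ginv = (\<lambda>x. matrix_inv (metric_matrix A g c x));
          x = snd c p
      in 1 / sqrt (G x) *
         (\<Sum>i\<in>UNIV. \<Sum>j\<in>UNIV.
            partial_deriv i
              (\<lambda>y. ginv y $ i $ j * sqrt (G y) * partial_deriv j (f \<circ> chart_inv c) y) x))"

end

theory Submission
  imports Defs
begin

text \<open>
  The proof pushes the region where the Laplacian may be negative along the connected set \<open>B\<close>
  until it lies inside \<open>W\<close>. The pushing device is a barrier on a coordinate ball of radius \<open>R\<close>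
  about \<open>x0\<close>: with \<open>\<psi>(x) = R\<^sup>2 - |x - x0|\<^sup>2\<close>, the function \<open>exp (- l / \<psi>)\<close>, extended by \<open>0\<close>, is
  smooth and supported in the closed ball. Up to positive factors its Laplacian is a bounded term
  plus \<open>(l - 2 \<psi>)\<close> times the squared length of the gradient of \<open>\<psi>\<close>. That length is bounded away
  from \<open>0\<close> outside any small ball about \<open>x0\<close>, so for large \<open>l\<close> the Laplacian is positive on the
  ball of radius \<open>R\<close> except near the centre (\<open>barrier\<close>, \<open>barrier_exists\<close>).

  Call a point \<open>q\<close> good if it lies in \<open>W\<close> or some smooth \<open>\<alpha> \<ge> 0\<close>, vanishing off \<open>B\<close> and
  subharmonic off \<open>W\<close>, has \<open>\<alpha>(q) > 0\<close> and \<open>\<Delta>\<alpha>(q) > 0\<close>. If \<open>t\<close> is good and \<open>q\<close> is another point of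
  a small coordinate ball about \<open>t\<close>, take a barrier centred at \<open>t\<close> that is strictly subharmonic at
  \<open>q\<close>. Its bad central ball can be chosen so small that it lies in \<open>W\<close> or in the region
  \<open>\<Delta>\<alpha> > 0\<close>; in the second case adding a large multiple of \<open>\<alpha>\<close> repairs the bad ball. Hence \<open>q\<close> is
  good (\<open>strict_at_push\<close>), goodness is locally constant on \<open>B\<close>, and by connectedness every
  point of \<open>B\<close> is good (\<open>strict_at_domain\<close>). Finitely many such functions, added up, serve for
  all of the compact set \<open>K\<close>.

  The sign of the Laplacian is required in every chart, while the barrier is computed in one. The
  bridge is the invariance of the coordinate formula (\<open>laplacian_change\<close>). Under a change of
  coordinates \<open>\<phi>\<close> with Jacobian matrix \<open>J\<close>, the flux \<open>\<surd>(det G) G\<inverse> \<nabla>f\<close> transforms by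
  \<open>|det J| J\<inverse>\<close>, so what is needed is that the columns of \<open>|det J| J\<inverse>\<close> are divergence free (\<open>piola\<close>). That identity is
  Jacobi's formula for the derivative of a determinant together with the symmetry of second
  derivatives. The local formulas also need the metric matrices to be positive definite, that is,
  the coordinate derivations to be linearly independent; small bumps with shifted centres
  detect this (\<open>coord_vectors_independent\<close>).
\<close>

section \<open>Calculus of partial derivatives\<close>

lemma partial_deriv_eq:
  fixes f :: "real^'n::finite \<Rightarrow> real"
  assumes "(f has_derivative f') (at x)"
  shows "partial_deriv i f x = f' (axis i 1)"
proof -
  have lin: "linear f'"
    using assms has_derivative_linear by blast
  have "((\<lambda>t::real. x + t *\<^sub>R axis i 1) has_derivative (\<lambda>t. t *\<^sub>R axis i 1)) (at 0)"
    by (auto intro!: derivative_eq_intros)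
  then have "((\<lambda>t. f (x + t *\<^sub>R axis i 1)) has_derivative (\<lambda>t. f' (t *\<^sub>R axis i 1))) (at 0)"
    by (rule has_derivative_compose) (use assms in simp)
  then have "((\<lambda>t. f (x + t *\<^sub>R axis i 1)) has_real_derivative f' (axis i 1)) (at 0)"
    unfolding has_field_derivative_def
    by (simp add: linear_cmul[OF lin] mult_commute_abs)
  then show ?thesis
    unfolding partial_deriv_def by (rule DERIV_imp_deriv)
qed

lemma linear_axis_expand:
  fixes f :: "real^'n::finite \<Rightarrow> real"
  assumes "linear f"
  shows "f h = (\<Sum>i\<in>UNIV. h $ i * f (axis i 1))"
proof -
  have "f h = f (\<Sum>i\<in>UNIV. (h$i) *s axis i 1)"
    by (simp add: basis_expansion)
  also have "\<dots> = (\<Sum>i\<in>UNIV. h $ i * f (axis i 1))"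
    by (simp add: linear_sum[OF assms] scalar_mult_eq_scaleR linear_cmul[OF assms])
  finally show ?thesis .
qed

lemma has_derivative_partial:
  fixes f :: "real^'n::finite \<Rightarrow> real"
  assumes "f differentiable (at x)"
  shows "(f has_derivative (\<lambda>h. \<Sum>i\<in>UNIV. h $ i * partial_deriv i f x)) (at x)"
proof -
  obtain f' where f': "(f has_derivative f') (at x)"
    using assms differentiable_def by blast
  have "f' = (\<lambda>h. \<Sum>i\<in>UNIV. h $ i * partial_deriv i f x)"
    by (rule ext, subst linear_axis_expand[OF has_derivative_linear[OF f']])
      (simp add: partial_deriv_eq[OF f'])
  then show ?thesis using f' by simp
qed

lemma partial_deriv_cong:
  assumes "open S" "x \<in> S" "\<And>y. y \<in> S \<Longrightarrow> f y = g y"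
  shows "partial_deriv i f x = partial_deriv i g x"
  unfolding partial_deriv_def
proof (rule deriv_cong_ev[OF _ refl])
  have "((\<lambda>t::real. x + t *\<^sub>R axis i 1) \<longlongrightarrow> x + 0 *\<^sub>R axis i 1) (nhds 0)"
    by (intro tendsto_intros filterlim_ident)
  then have "\<forall>\<^sub>F t::real in nhds 0. x + t *\<^sub>R axis i 1 \<in> S"
    by (rule topological_tendstoD) (use assms in auto)
  then show "\<forall>\<^sub>F t::real in nhds 0. f (x + t *\<^sub>R axis i 1) = g (x + t *\<^sub>R axis i 1)"
    by eventually_elim (use assms in auto)
qed

lemma partial_deriv_const: "partial_deriv i (\<lambda>_. a) x = 0"
  by (simp add: partial_deriv_def)

lemma partial_deriv_add:
  assumes "f differentiable (at x)" "g differentiable (at x)"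
  shows "partial_deriv i (\<lambda>y. f y + g y) x = partial_deriv i f x + partial_deriv i g x"
  using assms unfolding differentiable_def
  by (auto simp: partial_deriv_eq dest: partial_deriv_eq[OF has_derivative_add])

lemma partial_deriv_mult:
  assumes "f differentiable (at x)" "g differentiable (at x)"
  shows "partial_deriv i (\<lambda>y. f y * g y) x = partial_deriv i f x * g x + f x * partial_deriv i g x"
proof -
  obtain f' g' where "(f has_derivative f') (at x)" "(g has_derivative g') (at x)"
    using assms differentiable_def by blast
  then show ?thesis
    using partial_deriv_eq[OF has_derivative_mult, of f f' x g g' i] by (simp add: partial_deriv_eq)
qed

lemma partial_deriv_cmult:
  assumes "f differentiable (at x)"
  shows "partial_deriv i (\<lambda>y. a * f y) x = a * partial_deriv i f x"
  using partial_deriv_mult[of "\<lambda>_. a"] assms by (simp add: partial_deriv_const)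

lemma partial_deriv_sum:
  assumes "\<And>j. j \<in> J \<Longrightarrow> f j differentiable (at x)"
  shows "partial_deriv i (\<lambda>y. \<Sum>j\<in>J. f j y) x = (\<Sum>j\<in>J. partial_deriv i (f j) x)"
proof -
  have "((\<lambda>y. \<Sum>j\<in>J. f j y) has_derivative
      (\<lambda>h. \<Sum>j\<in>J. \<Sum>i\<in>UNIV. h $ i * partial_deriv i (f j) x)) (at x)"
    by (intro has_derivative_sum has_derivative_partial assms)
  from partial_deriv_eq[OF this, of i] show ?thesis
    by (simp add: axis_def if_distrib[where f="\<lambda>u. u * _"] cong: if_cong)
qed

lemma has_derivative_vec:
  fixes f :: "real^'m::finite \<Rightarrow> real^'n::finite"
  assumes "\<And>j. ((\<lambda>y. f y $ j) has_derivative (\<lambda>h. f' h $ j)) (at x)"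
  shows "(f has_derivative f') (at x)"
  unfolding has_derivative_componentwise_within[of f]
proof
  fix b :: "real^'n" assume "b \<in> Basis"
  then obtain j where "b = axis j 1"
    by (auto simp: Basis_vec_def)
  then show "((\<lambda>x. f x \<bullet> b) has_derivative (\<lambda>x. f' x \<bullet> b)) (at x)"
    using assms[of j] by (simp add: inner_axis)
qed

lemma has_derivative_chain:
  fixes f :: "real^'n::finite \<Rightarrow> real" and \<phi> :: "real^'m::finite \<Rightarrow> real^'n"
  assumes f: "f differentiable (at (\<phi> x))" and \<phi>: "\<And>j. (\<lambda>y. \<phi> y $ j) differentiable (at x)"
  shows "((\<lambda>y. f (\<phi> y)) has_derivative (\<lambda>h. \<Sum>j\<in>UNIV.
    (\<Sum>i\<in>UNIV. h $ i * partial_deriv i (\<lambda>y. \<phi> y $ j) x) * partial_deriv j f (\<phi> x))) (at x)"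
proof -
  have "(\<phi> has_derivative (\<lambda>h. \<chi> j. \<Sum>i\<in>UNIV. h $ i * partial_deriv i (\<lambda>y. \<phi> y $ j) x)) (at x)"
    by (rule has_derivative_vec) (simp add: has_derivative_partial[OF \<phi>])
  from has_derivative_compose[OF this has_derivative_partial[OF f]]
  show ?thesis by simp
qed

lemma partial_deriv_chain:
  fixes f :: "real^'n::finite \<Rightarrow> real" and \<phi> :: "real^'m::finite \<Rightarrow> real^'n"
  assumes "f differentiable (at (\<phi> x))" "\<And>j. (\<lambda>y. \<phi> y $ j) differentiable (at x)"
  shows "partial_deriv i (\<lambda>y. f (\<phi> y)) x =
    (\<Sum>j\<in>UNIV. partial_deriv i (\<lambda>y. \<phi> y $ j) x * partial_deriv j f (\<phi> x))"
  using partial_deriv_eq[OF has_derivative_chain[OF assms], of i]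
  by (simp add: axis_def if_distrib[where f="\<lambda>u. u * _"] cong: if_cong)

subsection \<open>The classes \<open>C\<^sup>k\<close>\<close>

lemma Ck_on_SucI:
  assumes "open S"
    and "\<And>x. x \<in> S \<Longrightarrow> f differentiable (at x)"
    and "\<And>i. Ck_on k S (partial_deriv i f)"
  shows "Ck_on (Suc k) S f"
  using assms by (simp add: differentiable_on_eq_differentiable_at)

lemma Ck_on_differentiable:
  assumes "Ck_on (Suc k) S f" "open S" "x \<in> S"
  shows "f differentiable (at x)"
  using assms by (simp add: differentiable_on_eq_differentiable_at)

lemma Ck_on_Suc_imp:
  "Ck_on (Suc k) S f \<Longrightarrow> Ck_on k S f"
proof (induction k arbitrary: f)
  case 0
  then show ?case by (simp add: differentiable_imp_continuous_on)
next
  case (Suc k)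
  from Suc.prems have "f differentiable_on S" "\<And>i. Ck_on (Suc k) S (partial_deriv i f)"
    by simp_all
  with Suc.IH show ?case by simp
qed

lemma Ck_on_continuous: "Ck_on k S f \<Longrightarrow> continuous_on S f"
  by (cases k) (auto simp: differentiable_imp_continuous_on)

lemma Ck_on_cong:
  assumes "open S" "\<And>x. x \<in> S \<Longrightarrow> f x = g x" "Ck_on k S f"
  shows "Ck_on k S g"
  using assms(2,3)
proof (induction k arbitrary: f g)
  case 0
  then show ?case by (simp cong: continuous_on_cong)
next
  case (Suc k)
  show ?case
  proof (rule Ck_on_SucI[OF assms(1)])
    fix x assume x: "x \<in> S"
    from Ck_on_differentiable[OF Suc.prems(2) assms(1) x]
    show "g differentiable (at x)"
      unfolding differentiable_def
      by (metis Suc.prems(1) has_derivative_transform_within_open[OF _ assms(1) x])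
  next
    fix i
    show "Ck_on k S (partial_deriv i g)"
    proof (rule Suc.IH)
      show "partial_deriv i f x = partial_deriv i g x" if "x \<in> S" for x
        using partial_deriv_cong[OF assms(1) that] Suc.prems(1) by blast
    qed (use Suc.prems in simp)
  qed
qed

text \<open>
  Functions on the manifold given by different formulas on different open pieces are smooth
  because the classes \<open>C\<^sup>k\<close> are local.
\<close>

lemma Ck_on_local:
  assumes "\<And>x. x \<in> S \<Longrightarrow> \<exists>U. open U \<and> x \<in> U \<and> U \<subseteq> S \<and> Ck_on k U f" "open S"
  shows "Ck_on k S f"
  using assms(1)
proof (induction k arbitrary: f)
  case 0
  have "\<forall>x\<in>S. isCont f x"
    using 0 by (metis Ck_on.simps(1) continuous_on_eq_continuous_at)
  then show ?case by (simp add: assms(2) continuous_on_eq_continuous_at)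
next
  case (Suc k)
  show ?case
  proof (rule Ck_on_SucI[OF assms(2)])
    show "f differentiable (at x)" if "x \<in> S" for x
      using Suc.prems[OF that] Ck_on_differentiable by blast
    show "Ck_on k S (partial_deriv i f)" for i
    proof (rule Suc.IH)
      fix x assume "x \<in> S"
      then show "\<exists>U. open U \<and> x \<in> U \<and> U \<subseteq> S \<and> Ck_on k U (partial_deriv i f)"
        using Suc.prems by fastforce
    qed
  qed
qed

lemma Ck_on_subset: "Ck_on k S f \<Longrightarrow> T \<subseteq> S \<Longrightarrow> Ck_on k T f"
proof (induction k arbitrary: f)
  case 0
  then show ?case by (auto intro: continuous_on_subset)
next
  case (Suc k)
  then show ?case by (auto intro: differentiable_on_subset)
qed

lemma Ck_on_const: "open S \<Longrightarrow> Ck_on k S (\<lambda>_. a)"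
proof (induction k arbitrary: a)
  case (Suc k)
  have "partial_deriv i (\<lambda>_. a) = (\<lambda>_. 0)" for i :: 'a
    by (simp add: partial_deriv_const fun_eq_iff)
  with Suc show ?case by simp
qed simp

lemma Ck_on_coord: "open S \<Longrightarrow> Ck_on k S (\<lambda>x. x $ j)"
proof (cases k)
  case (Suc l)
  assume S: "open S"
  have d: "((\<lambda>x::real^'a. x $ j) has_derivative (\<lambda>h. h $ j)) (at x)" for x
    using bounded_linear_imp_has_derivative[OF bounded_linear_vec_nth[of j]] .
  have "partial_deriv i (\<lambda>x. x $ j) = (\<lambda>_. axis i 1 $ j)" for i :: 'a
    using partial_deriv_eq[OF d] by (simp add: fun_eq_iff)
  then show ?thesis
    unfolding Suc using S d by (intro Ck_on_SucI) (auto simp: Ck_on_const differentiable_def)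
qed (auto intro: continuous_intros)

lemma Ck_on_add:
  "open S \<Longrightarrow> Ck_on k S f \<Longrightarrow> Ck_on k S g \<Longrightarrow> Ck_on k S (\<lambda>x. f x + g x)"
proof (induction k arbitrary: f g)
  case 0
  then show ?case by (auto intro: continuous_intros)
next
  case (Suc k)
  note d = Ck_on_differentiable[OF Suc.prems(2,1)] Ck_on_differentiable[OF Suc.prems(3,1)]
  show ?case
  proof (rule Ck_on_SucI[OF Suc.prems(1)])
    show "Ck_on k S (partial_deriv i (\<lambda>x. f x + g x))" for i
    proof (rule Ck_on_cong[OF Suc.prems(1)])
      show "Ck_on k S (\<lambda>x. partial_deriv i f x + partial_deriv i g x)"
        using Suc by simp
    qed (simp add: partial_deriv_add d)
  qed (simp add: d)
qed

lemma Ck_on_mult: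
  "open S \<Longrightarrow> Ck_on k S f \<Longrightarrow> Ck_on k S g \<Longrightarrow> Ck_on k S (\<lambda>x. f x * g x)"
proof (induction k arbitrary: f g)
  case 0
  then show ?case by (auto intro: continuous_intros)
next
  case (Suc k)
  note d = Ck_on_differentiable[OF Suc.prems(2,1)] Ck_on_differentiable[OF Suc.prems(3,1)]
  show ?case
  proof (rule Ck_on_SucI[OF Suc.prems(1)])
    show "Ck_on k S (partial_deriv i (\<lambda>x. f x * g x))" for i
    proof (rule Ck_on_cong[OF Suc.prems(1)])
      show "Ck_on k S (\<lambda>x. partial_deriv i f x * g x + f x * partial_deriv i g x)"
        using Suc.prems Suc.IH Ck_on_Suc_imp[OF Suc.prems(2)] Ck_on_Suc_imp[OF Suc.prems(3)]
        by (intro Ck_on_add Suc.IH) auto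
    qed (simp add: partial_deriv_mult d)
  qed (simp add: d)
qed

lemma Ck_on_sum:
  assumes "open S" "\<And>j. j \<in> J \<Longrightarrow> Ck_on k S (f j)"
  shows "Ck_on k S (\<lambda>x. \<Sum>j\<in>J. f j x)"
  using assms(2)
  by (induction J rule: infinite_finite_induct) (auto intro: Ck_on_add Ck_on_const assms(1))

lemma Ck_on_prod:
  assumes "open S" "\<And>j. j \<in> J \<Longrightarrow> Ck_on k S (f j)"
  shows "Ck_on k S (\<lambda>x. \<Prod>j\<in>J. f j x)"
  using assms(2)
  by (induction J rule: infinite_finite_induct) (auto intro: Ck_on_mult Ck_on_const assms(1))

lemma Ck_on_compose:
  fixes f :: "real^'n::finite \<Rightarrow> real" and \<phi> :: "real^'m::finite \<Rightarrow> real^'n"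
  assumes "open S" "open T" "\<phi> ` S \<subseteq> T"
    and "Ck_on k T f" "\<And>j. Ck_on k S (\<lambda>x. \<phi> x $ j)"
  shows "Ck_on k S (\<lambda>x. f (\<phi> x))"
  using assms(4,5)
proof (induction k arbitrary: f)
  case 0
  have "continuous_on S (\<lambda>x. \<chi> j. \<phi> x $ j)"
    by (rule continuous_on_vec_lambda) (use 0 in simp)
  then have "continuous_on S \<phi>" by simp
  then show ?case
    using 0 assms(3) by (auto intro: continuous_on_compose2)
next
  case (Suc k)
  have d: "f differentiable (at (\<phi> x))" "(\<lambda>y. \<phi> y $ j) differentiable (at x)" if "x \<in> S" for x j
    using that assms Ck_on_differentiable[OF Suc.prems(1)] Ck_on_differentiable[OF Suc.prems(2)] by auto
  show ?case
  proof (rule Ck_on_SucI[OF assms(1)])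
    show "(\<lambda>x. f (\<phi> x)) differentiable (at x)" if "x \<in> S" for x
      using has_derivative_chain[OF d(1,2)[OF that]] differentiable_def by blast
    show "Ck_on k S (partial_deriv i (\<lambda>x. f (\<phi> x)))" for i
    proof (rule Ck_on_cong[OF assms(1)])
      show "Ck_on k S (\<lambda>x. \<Sum>j\<in>UNIV. partial_deriv i (\<lambda>y. \<phi> y $ j) x * partial_deriv j f (\<phi> x))"
      proof (intro Ck_on_sum Ck_on_mult assms(1))
        show "Ck_on k S (partial_deriv i (\<lambda>y. \<phi> y $ j))" for j
          using Suc.prems(2) by simp
        show "Ck_on k S (\<lambda>x. partial_deriv j f (\<phi> x))" for j
        proof (rule Suc.IH)
          show "Ck_on k T (partial_deriv j f)" using Suc.prems(1) by simp
          show "Ck_on k S (\<lambda>x. \<phi> x $ l)" for l by (rule Ck_on_Suc_imp[OF Suc.prems(2)])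
        qed
      qed
    qed (simp add: partial_deriv_chain d)
  qed
qed

lemma partial_deriv_real_chain:
  assumes "(h has_real_derivative d) (at (f x))" "f differentiable (at x)"
  shows "partial_deriv i (\<lambda>y. h (f y)) x = d * partial_deriv i f x"
    and "(\<lambda>y. h (f y)) differentiable (at x)"
proof -
  obtain f' where f': "(f has_derivative f') (at x)"
    using assms(2) differentiable_def by blast
  have *: "((\<lambda>y. h (f y)) has_derivative (\<lambda>y. d * f' y)) (at x)"
    using has_derivative_compose[OF f' assms(1)[unfolded has_field_derivative_def]] .
  show "partial_deriv i (\<lambda>y. h (f y)) x = d * partial_deriv i f x"
    using partial_deriv_eq[OF *] partial_deriv_eq[OF f'] by simp
  show "(\<lambda>y. h (f y)) differentiable (at x)"
    using * differentiable_def by blast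
qed

lemma Ck_on_powr:
  "open S \<Longrightarrow> Ck_on k S f \<Longrightarrow> (\<And>x. x \<in> S \<Longrightarrow> f x > 0) \<Longrightarrow> Ck_on k S (\<lambda>x. f x powr a)"
proof (induction k arbitrary: a)
  case 0
  then have "\<forall>x\<in>S. f x \<noteq> 0" by fastforce
  with 0 show ?case
    by (auto intro!: continuous_on_powr continuous_intros)
next
  case (Suc k)
  have d: "f differentiable (at x)" if "x \<in> S" for x
    using Ck_on_differentiable[OF Suc.prems(2,1) that] .
  note p = partial_deriv_real_chain[where h="\<lambda>z. z powr a", OF has_real_derivative_powr d]
  show ?case
  proof (rule Ck_on_SucI[OF Suc.prems(1)])
    show "Ck_on k S (partial_deriv i (\<lambda>x. f x powr a))" for i
    proof (rule Ck_on_cong[OF Suc.prems(1)])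
      show "Ck_on k S (\<lambda>x. (a * f x powr (a - 1)) * partial_deriv i f x)"
        using Suc.prems Ck_on_Suc_imp[OF Suc.prems(2)]
        by (intro Ck_on_mult Ck_on_const Suc.IH) auto
    qed (simp add: p Suc.prems(3))
  qed (simp add: p Suc.prems(3))
qed

lemma smooth_onD: "smooth_on S f \<Longrightarrow> Ck_on k S f"
  by (simp add: smooth_on_def)

lemma smooth_on_partial: "smooth_on S f \<Longrightarrow> smooth_on S (partial_deriv i f)"
  unfolding smooth_on_def using Ck_on.simps(2) by blast

lemma smooth_on_differentiable:
  "smooth_on S f \<Longrightarrow> open S \<Longrightarrow> x \<in> S \<Longrightarrow> f differentiable (at x)"
  using Ck_on_differentiable smooth_onD by blast

subsection \<open>Symmetry of second derivatives\<close>

text \<open>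
  The second difference over a square is symmetric in the two directions, and the mean value
  theorem, applied once in each direction, turns it into a mixed derivative. Exchanging the
  directions gives the symmetry of second derivatives below.
\<close>

lemma second_difference:
  fixes f :: "real^'n::finite \<Rightarrow> real"
  assumes S: "open S" "Ck_on 2 S f" and s: "s > 0" and sub: "cball x (2 * s) \<subseteq> S"
  shows "\<exists>y \<in> cball x (2 * s). f (x + s *\<^sub>R axis i 1 + s *\<^sub>R axis j 1) - f (x + s *\<^sub>R axis i 1)
     - f (x + s *\<^sub>R axis j 1) + f x = s * s * partial_deriv j (partial_deriv i f) y"
proof -
  let ?a = "axis i 1 :: real^'n" and ?b = "axis j 1 :: real^'n"
  have C1: "Ck_on (Suc 0) S (partial_deriv i f)" "Ck_on (Suc (Suc 0)) S f"
    using S by (simp_all add: numeral_2_eq_2)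
  have inS: "x + t *\<^sub>R ?a + u *\<^sub>R ?b \<in> cball x (2 * s)" if "0 \<le> t" "t \<le> s" "0 \<le> u" "u \<le> s" for t u
  proof -
    have "norm (t *\<^sub>R ?a + u *\<^sub>R ?b) \<le> t + u"
      using norm_triangle_ineq[of "t *\<^sub>R ?a" "u *\<^sub>R ?b"] that by simp
    then have "norm (t *\<^sub>R ?a + u *\<^sub>R ?b) \<le> 2 * s" using that by linarith
    moreover have "dist x (x + t *\<^sub>R ?a + u *\<^sub>R ?b) = norm (t *\<^sub>R ?a + u *\<^sub>R ?b)"
      by (metis add.assoc add_diff_cancel_left' dist_commute dist_norm)
    ultimately show ?thesis by simp
  qed
  have DERIV: "((\<lambda>t. h (z + t *\<^sub>R axis l 1)) has_real_derivative partial_deriv l h (z + t *\<^sub>R axis l 1)) (at t)"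
    if "h differentiable (at (z + t *\<^sub>R axis l 1))" for h :: "real^'n \<Rightarrow> real" and z t l
  proof -
    have 1: "((\<lambda>t::real. z + t *\<^sub>R axis l 1) has_derivative (\<lambda>t. t *\<^sub>R axis l 1)) (at t)"
      by (auto intro!: derivative_eq_intros)
    show ?thesis
      using has_derivative_compose[OF 1 has_derivative_partial[OF that]]
      unfolding has_field_derivative_def
      by (simp add: axis_def if_distrib[where f="\<lambda>u. _ * u"] if_distrib[where f="\<lambda>u. u * _"] mult_commute_abs cong: if_cong)
  qed
  have "\<exists>z::real. z > 0 \<and> z < s \<and>
      (f ((x + s *\<^sub>R ?b) + s *\<^sub>R ?a) - f (x + s *\<^sub>R ?a)) - (f ((x + s *\<^sub>R ?b) + 0 *\<^sub>R ?a) - f (x + 0 *\<^sub>R ?a))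
       = (s - 0) * (partial_deriv i f ((x + s *\<^sub>R ?b) + z *\<^sub>R ?a) - partial_deriv i f (x + z *\<^sub>R ?a))"
  proof (rule MVT2[OF s])
    fix t :: real assume t: "0 \<le> t" "t \<le> s"
    have "(x + s *\<^sub>R ?b) + t *\<^sub>R ?a \<in> S" "x + t *\<^sub>R ?a \<in> S"
      using inS[OF t, of s] inS[OF t, of 0] sub s by (auto simp: algebra_simps)
    then show "((\<lambda>t. f ((x + s *\<^sub>R ?b) + t *\<^sub>R ?a) - f (x + t *\<^sub>R ?a)) has_real_derivative
      partial_deriv i f ((x + s *\<^sub>R ?b) + t *\<^sub>R ?a) - partial_deriv i f (x + t *\<^sub>R ?a)) (at t)"
      by (intro DERIV_diff DERIV Ck_on_differentiable[OF C1(2) S(1)])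
  qed
  then obtain t where t: "0 < t" "t < s" and 1:
      "(f ((x + s *\<^sub>R ?b) + s *\<^sub>R ?a) - f (x + s *\<^sub>R ?a)) - (f ((x + s *\<^sub>R ?b) + 0 *\<^sub>R ?a) - f (x + 0 *\<^sub>R ?a))
       = (s - 0) * (partial_deriv i f ((x + s *\<^sub>R ?b) + t *\<^sub>R ?a) - partial_deriv i f (x + t *\<^sub>R ?a))"
    by blast
  have "\<exists>z::real. z > 0 \<and> z < s \<and>
     partial_deriv i f ((x + t *\<^sub>R ?a) + s *\<^sub>R ?b) - partial_deriv i f ((x + t *\<^sub>R ?a) + 0 *\<^sub>R ?b)
       = (s - 0) * partial_deriv j (partial_deriv i f) ((x + t *\<^sub>R ?a) + z *\<^sub>R ?b)"
  proof (rule MVT2[OF s])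
    fix u :: real assume u: "0 \<le> u" "u \<le> s"
    have "(x + t *\<^sub>R ?a) + u *\<^sub>R ?b \<in> S"
      using inS[of t u] sub t u by auto
    then show "((\<lambda>u. partial_deriv i f ((x + t *\<^sub>R ?a) + u *\<^sub>R ?b)) has_real_derivative
        partial_deriv j (partial_deriv i f) ((x + t *\<^sub>R ?a) + u *\<^sub>R ?b)) (at u)"
      by (intro DERIV Ck_on_differentiable[OF C1(1) S(1)])
  qed
  then obtain u where u: "0 < u" "u < s" and 2:
     "partial_deriv i f ((x + t *\<^sub>R ?a) + s *\<^sub>R ?b) - partial_deriv i f ((x + t *\<^sub>R ?a) + 0 *\<^sub>R ?b)
       = (s - 0) * partial_deriv j (partial_deriv i f) ((x + t *\<^sub>R ?a) + u *\<^sub>R ?b)"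
    by blast
  show ?thesis
  proof
    show "x + t *\<^sub>R ?a + u *\<^sub>R ?b \<in> cball x (2 * s)" using inS t u by simp
    show "f (x + s *\<^sub>R axis i 1 + s *\<^sub>R axis j 1) - f (x + s *\<^sub>R axis i 1)
     - f (x + s *\<^sub>R axis j 1) + f x = s * s * partial_deriv j (partial_deriv i f) (x + t *\<^sub>R ?a + u *\<^sub>R ?b)"
      using 1 2 by (simp add: add_ac)
  qed
qed

lemma partial_deriv_commute:
  fixes f :: "real^'n::finite \<Rightarrow> real"
  assumes S: "open S" "Ck_on 2 S f" and x: "x \<in> S"
  shows "partial_deriv i (partial_deriv j f) x = partial_deriv j (partial_deriv i f) x"
proof (rule ccontr)
  let ?p = "partial_deriv i (partial_deriv j f)" and ?q = "partial_deriv j (partial_deriv i f)"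
  assume ne: "?p x \<noteq> ?q x"
  define e where "e = \<bar>?p x - ?q x\<bar> / 2"
  have e: "e > 0" using ne by (simp add: e_def)
  have "isCont ?p x" "isCont ?q x"
    using S x by (simp_all add: numeral_2_eq_2 continuous_on_eq_continuous_at)
  then obtain r1 r2 where r: "r1 > 0" "r2 > 0"
     "\<And>y. dist y x < r1 \<Longrightarrow> dist (?p y) (?p x) < e"
     "\<And>y. dist y x < r2 \<Longrightarrow> dist (?q y) (?q x) < e"
    using e unfolding continuous_at_eps_delta by metis
  obtain r3 where r3: "r3 > 0" "cball x r3 \<subseteq> S"
    using S(1) x open_contains_cball by blast
  define s where "s = min r3 (min r1 r2) / 4"
  have s: "s > 0" "2 * s < r1" "2 * s < r2" "2 * s \<le> r3"
    using r(1,2) r3(1) by (auto simp: s_def min_def)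
  then have sub: "cball x (2 * s) \<subseteq> S" using r3 by force
  obtain y z where y: "y \<in> cball x (2 * s)" "z \<in> cball x (2 * s)"
     "f (x + s *\<^sub>R axis i 1 + s *\<^sub>R axis j 1) - f (x + s *\<^sub>R axis i 1)
     - f (x + s *\<^sub>R axis j 1) + f x = s * s * ?q y"
     "f (x + s *\<^sub>R axis j 1 + s *\<^sub>R axis i 1) - f (x + s *\<^sub>R axis j 1)
     - f (x + s *\<^sub>R axis i 1) + f x = s * s * ?p z"
    using second_difference[OF S s(1) sub, of i j] second_difference[OF S s(1) sub, of j i] by blast
  have swap: "x + s *\<^sub>R axis i 1 + s *\<^sub>R axis j 1 = x + s *\<^sub>R axis j 1 + s *\<^sub>R axis i 1"
    by (simp add: add_ac)
  have "s * s * ?q y = s * s * ?p z"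
    using y(3,4) unfolding swap by linarith
  then have eq: "?q y = ?p z" using s by simp
  have "dist (?p z) (?p x) < e" "dist (?q y) (?q x) < e"
    using r(3)[of z] r(4)[of y] y(1,2) s by (auto simp: dist_commute)
  then have "\<bar>?p x - ?q x\<bar> < e + e"
    using eq unfolding dist_real_def by linarith
  then show False by (simp add: e_def)
qed

section \<open>A flat function\<close>

text \<open>
  The powers of \<open>t\<close> in the denominator make the family closed under differentiation, so that
  smoothness of all its members follows by one induction on the order of differentiability.
\<close>

definition flat :: "real \<Rightarrow> nat \<Rightarrow> real \<Rightarrow> real" where
  "flat l k t = (if t > 0 then exp (- l / t) / t ^ k else 0)"

lemma flat_nonneg: "flat l k t \<ge> 0"
  by (simp add: flat_def)

text \<open>
  Since \<open>exp (l / t) = (exp (l / (t m)))\<^sup>m \<ge> (l / (t m))\<^sup>m\<close> for \<open>m = k + 2\<close>, the flat function is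
  quadratically small at \<open>0\<close>; this gives the derivative \<open>0\<close> there.
\<close>

lemma flat_le:
  assumes "l > 0"
  shows "flat l k t \<le> (real (k + 2) / l) ^ (k + 2) * t\<^sup>2"
proof (cases "t > 0")
  case True
  define m where "m = k + 2"
  have m: "real m > 0" by (simp add: m_def)
  have "l / (t * real m) \<le> exp (l / (t * real m))"
    using exp_ge_add_one_self[of "l / (t * real m)"] by linarith
  then have "(l / (t * real m)) ^ m \<le> exp (l / (t * real m)) ^ m"
    using assms True m by (intro power_mono) auto
  also have "\<dots> = exp (l / t)"
    using m by (simp flip: exp_of_nat_mult)
  finally have "(l / (t * real m)) ^ m \<le> exp (l / t)" .
  then have "inverse (exp (l / t)) \<le> inverse ((l / (t * real m)) ^ m)"
    using assms True m by (intro le_imp_inverse_le) auto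
  also have "\<dots> = (real m / l) ^ m * t ^ m"
    using True assms m by (simp add: field_simps power_divide power_mult_distrib)
  finally have "exp (- l / t) \<le> (real m / l) ^ m * t ^ m"
    by (simp add: exp_minus)
  then have "exp (- l / t) / t ^ k \<le> (real m / l) ^ m * t ^ m / t ^ k"
    using True by (intro divide_right_mono) auto
  also have "\<dots> = (real m / l) ^ m * t\<^sup>2"
    using True by (simp add: m_def power_add power2_eq_square)
  finally show ?thesis using True by (simp add: flat_def m_def)
next
  case False
  then show ?thesis using assms by (simp add: flat_def)
qed

lemma flat_has_derivative:
  assumes l: "l > 0"
  shows "(flat l k has_real_derivative l * flat l (k + 2) t - real k * flat l (k + 1) t) (at t)"
proof -
  consider "t > 0" | "t < 0" | "t = 0" by linarith
  then show ?thesis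
  proof cases
    case 1
    have "((\<lambda>t. exp (- l / t) / t ^ k) has_real_derivative
        l * flat l (k + 2) t - real k * flat l (k + 1) t) (at t)"
    proof -
      have e: "((\<lambda>t. exp (- l / t)) has_real_derivative exp (- l / t) * (l / t\<^sup>2)) (at t)"
        using 1 by (auto intro!: derivative_eq_intros simp: power2_eq_square)
      have "real k * t ^ (k - 1) * t = real k * t ^ k"
        by (cases k) auto
      then have p: "real k * t ^ (k - Suc 0) = real k * t ^ k / t"
        using 1 by (simp add: field_simps)
      show ?thesis
        by (rule DERIV_cong[OF DERIV_divide[OF e DERIV_pow[of k t]]], use 1 in simp, unfold p)
           (use 1 in \<open>simp add: flat_def field_simps power2_eq_square\<close>)
    qed
    then show ?thesis
      by (rule has_field_derivative_transform_within_open[where S="{0<..}"])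
         (use 1 in \<open>auto simp: flat_def\<close>)
  next
    case 2
    have "((\<lambda>_. 0) has_real_derivative 0) (at t)" by simp
    then have "(flat l k has_real_derivative 0) (at t)"
      by (rule has_field_derivative_transform_within_open[where S="{..<0}"])
         (use 2 in \<open>auto simp: flat_def\<close>)
    then show ?thesis using 2 by (simp add: flat_def)
  next
    case 3
    let ?C = "(real (k + 2) / l) ^ (k + 2)"
    have "(\<lambda>h. (flat l k (0 + h) - flat l k 0) / h) \<midarrow>0\<rightarrow> 0"
    proof (rule Lim_null_comparison)
      show "\<forall>\<^sub>F h in at 0. norm ((flat l k (0 + h) - flat l k 0) / h) \<le> ?C * \<bar>h\<bar>"
      proof (rule eventually_at_filter[THEN iffD2], rule always_eventually, intro allI impI)
        fix h :: real assume h: "h \<noteq> 0"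
        have "flat l k h / \<bar>h\<bar> \<le> ?C * h\<^sup>2 / \<bar>h\<bar>"
          by (intro divide_right_mono flat_le l) auto
        also have "\<dots> = ?C * \<bar>h\<bar>" using h by (simp add: power2_eq_square abs_if)
        finally show "norm ((flat l k (0 + h) - flat l k 0) / h) \<le> ?C * \<bar>h\<bar>"
          by (simp add: flat_nonneg[of l k h]) (simp add: flat_def)
      qed
      have "((\<lambda>h. ?C * \<bar>h\<bar>) \<longlongrightarrow> ?C * \<bar>0\<bar>) (at 0)"
        by (intro tendsto_intros)
      then show "((\<lambda>h. ?C * \<bar>h\<bar>) \<longlongrightarrow> 0) (at 0)" by simp
    qed
    then have "(flat l k has_real_derivative 0) (at 0)"
      by (simp add: DERIV_def)
    then show ?thesis using 3 by (simp add: flat_def)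
  qed
qed

lemma Ck_on_flat:
  "open S \<Longrightarrow> l > 0 \<Longrightarrow> Ck_on k S f \<Longrightarrow> Ck_on k S (\<lambda>x. flat l m (f x))"
proof (induction k arbitrary: m)
  case 0
  have "continuous_on UNIV (flat l m)"
    by (rule DERIV_continuous_on, rule DERIV_subset, rule flat_has_derivative[OF 0(2)]) simp
  then show ?case
    using continuous_on_compose2[of UNIV "flat l m" S f] 0(3) by simp
next
  case (Suc k)
  have d: "f differentiable (at x)" if "x \<in> S" for x
    using Ck_on_differentiable[OF Suc.prems(3,1) that] .
  note p = partial_deriv_real_chain[where h="flat l m", OF flat_has_derivative[OF Suc.prems(2)] d]
  show ?case
  proof (rule Ck_on_SucI[OF Suc.prems(1)])
    show "Ck_on k S (partial_deriv i (\<lambda>x. flat l m (f x)))" for i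
    proof (rule Ck_on_cong[OF Suc.prems(1)])
      have "Ck_on k S (\<lambda>x. flat l n (f x))" for n
        by (rule Suc.IH[OF Suc.prems(1,2) Ck_on_Suc_imp[OF Suc.prems(3)]])
      moreover have "Ck_on k S (partial_deriv i f)"
        using Suc.prems(3) by simp
      ultimately show "Ck_on k S (\<lambda>x. (l * flat l (m + 2) (f x) + (- real m) * flat l (m + 1) (f x)) * partial_deriv i f x)"
        by (intro Ck_on_mult Ck_on_add Ck_on_const Suc.prems(1))
    qed (simp add: p)
  qed (simp add: p)
qed

section \<open>Determinants and inverse matrices\<close>

lemma det_replaced_row_expand:
  fixes M :: "real^'n::finite^'n"
  shows "det (\<chi> r. if r = i then b else row r M) =
    (\<Sum>p | p permutes UNIV. of_int (sign p) * (b $ p i * (\<Prod>j\<in>UNIV - {i}. M $ j $ p j)))"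
  unfolding det_def
proof (rule sum.cong[OF refl])
  fix p :: "'n \<Rightarrow> 'n"
  have "(\<Prod>r\<in>UNIV. (\<chi> r. if r = i then b else row r M) $ r $ p r)
      = (\<chi> r. if r = i then b else row r M) $ i $ p i * (\<Prod>r\<in>UNIV - {i}. (\<chi> r. if r = i then b else row r M) $ r $ p r)"
    by (rule prod.remove) auto
  also have "(\<Prod>r\<in>UNIV - {i}. (\<chi> r. if r = i then b else row r M) $ r $ p r) = (\<Prod>j\<in>UNIV - {i}. M $ j $ p j)"
    by (rule prod.cong) (auto simp: row_def)
  finally show "of_int (sign p) * (\<Prod>r\<in>UNIV. (\<chi> r. if r = i then b else row r M) $ r $ p r) =
     of_int (sign p) * (b $ p i * (\<Prod>j\<in>UNIV - {i}. M $ j $ p j))"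
    by simp
qed

text \<open>
  The new row is the combination of the old rows with coefficients from \<open>B ** N\<close>, so this is
  Cramer's rule for the transpose.
\<close>

lemma det_replaced_row:
  fixes M N B :: "real^'n::finite^'n"
  assumes "N ** M = mat 1"
  shows "det (\<chi> r. if r = i then B $ i else row r M) = (B ** N) $ i $ i * det M"
proof -
  have "B = (B ** N) ** M"
    by (simp add: assms flip: matrix_mul_assoc)
  then have B: "B $ i = (\<Sum>l\<in>UNIV. (B ** N) $ i $ l *s row l M)"
    by (subst (asm) vec_eq_iff)
       (simp add: vec_eq_iff row_def matrix_matrix_mult_def[of "B ** N" M])
  show ?thesis
    unfolding B by (rule cramer_lemma_transpose)
qed

text \<open>
  Jacobi's formula. Differentiating the Leibniz formula factor by factor replaces one row of the
  matrix at a time by its derivative.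
\<close>

lemma partial_deriv_det:
  fixes M :: "real^'m::finite \<Rightarrow> real^'n::finite^'n"
  assumes d: "\<And>i j. (\<lambda>y. M y $ i $ j) differentiable (at x)" and N: "N ** M x = mat 1"
  shows "partial_deriv k (\<lambda>y. det (M y)) x =
      (\<Sum>i\<in>UNIV. \<Sum>j\<in>UNIV. partial_deriv k (\<lambda>y. M y $ i $ j) x * N $ j $ i) * det (M x)"
    and "(\<lambda>y. det (M y)) differentiable (at x)"
proof -
  let ?D = "\<lambda>i j h. \<Sum>l\<in>UNIV. h $ l * partial_deriv l (\<lambda>y. M y $ i $ j) x"
  have der: "((\<lambda>y. det (M y)) has_derivative (\<lambda>h. \<Sum>p | p permutes (UNIV::'n set). of_int (sign p) *
      (\<Sum>i\<in>UNIV. ?D i (p i) h * (\<Prod>j\<in>UNIV - {i}. M x $ j $ p j)))) (at x)"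
    unfolding det_def
    by (intro has_derivative_sum has_derivative_mult_right has_derivative_prod has_derivative_partial d)
  then show "(\<lambda>y. det (M y)) differentiable (at x)"
    using differentiable_def by blast
  define B :: "real^'n^'n" where "B = (\<chi> i j. partial_deriv k (\<lambda>y. M y $ i $ j) x)"
  have D: "?D i j (axis k 1) = B $ i $ j" for i j
    by (simp add: B_def axis_def if_distrib[where f="\<lambda>u. u * _"] cong: if_cong)
  have "partial_deriv k (\<lambda>y. det (M y)) x = (\<Sum>p | p permutes (UNIV::'n set). of_int (sign p) *
      (\<Sum>i\<in>UNIV. B $ i $ p i * (\<Prod>j\<in>UNIV - {i}. M x $ j $ p j)))"
    using partial_deriv_eq[OF der, of k] by (simp only: D)
  also have "\<dots> = (\<Sum>i\<in>UNIV. \<Sum>p | p permutes (UNIV::'n set). of_int (sign p) *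
      (B $ i $ p i * (\<Prod>j\<in>UNIV - {i}. M x $ j $ p j)))"
    unfolding sum_distrib_left by (rule sum.swap)
  also have "\<dots> = (\<Sum>i\<in>UNIV. det (\<chi> r. if r = i then B $ i else row r (M x)))"
    by (simp only: det_replaced_row_expand)
  also have "\<dots> = (\<Sum>i\<in>UNIV. (B ** N) $ i $ i * det (M x))"
    by (simp only: det_replaced_row[OF N])
  also have "\<dots> = (\<Sum>i\<in>UNIV. \<Sum>j\<in>UNIV. B $ i $ j * N $ j $ i) * det (M x)"
    by (simp add: matrix_matrix_mult_def sum_distrib_right)
  finally show "partial_deriv k (\<lambda>y. det (M y)) x =
      (\<Sum>i\<in>UNIV. \<Sum>j\<in>UNIV. partial_deriv k (\<lambda>y. M y $ i $ j) x * N $ j $ i) * det (M x)"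
    by (simp add: B_def)
qed

lemma matrix_inv_works:
  fixes M :: "real^'n::finite^'n"
  assumes "det M \<noteq> 0"
  shows "M ** matrix_inv M = mat 1" "matrix_inv M ** M = mat 1"
proof -
  have "\<exists>N. M ** N = mat 1 \<and> N ** M = mat 1"
    using assms by (metis invertible_def invertible_det_nz)
  then have "M ** matrix_inv M = mat 1 \<and> matrix_inv M ** M = mat 1"
    unfolding matrix_inv_def by (rule someI_ex)
  then show "M ** matrix_inv M = mat 1" "matrix_inv M ** M = mat 1" by auto
qed

lemma matrix_inv_eqI:
  fixes M N :: "real^'n::finite^'n"
  assumes "M ** N = mat 1"
  shows "matrix_inv M = N"
proof -
  have "det M \<noteq> 0"
    using assms by (metis invertible_det_nz invertible_right_inverse)
  then have "matrix_inv M = matrix_inv M ** (M ** N)"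
    by (simp add: assms)
  also have "\<dots> = N"
    by (simp add: matrix_mul_assoc matrix_inv_works \<open>det M \<noteq> 0\<close>)
  finally show ?thesis .
qed

text \<open>
  Cramer's rule exhibits the entries of the inverse as rational functions of the entries, hence as
  smooth functions of a smooth matrix.
\<close>

lemma matrix_inv_cramer:
  fixes M :: "real^'n::finite^'n"
  assumes "det M \<noteq> 0"
  shows "matrix_inv M $ i $ j =
    det (\<chi> r s. if s = i then (if r = j then 1 else 0) else M $ r $ s) / det M"
proof -
  have "M *v (matrix_inv M *v axis j 1) = axis j 1"
    by (simp add: matrix_vector_mul_assoc matrix_inv_works[OF assms])
  then have "matrix_inv M *v axis j 1 =
      (\<chi> k. det (\<chi> r s. if s = k then axis j 1 $ r else M $ r $ s) / det M)"
    by (simp only: cramer[OF assms])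
  then have "(matrix_inv M *v axis j 1) $ i =
      det (\<chi> r s. if s = i then axis j 1 $ r else M $ r $ s) / det M"
    by simp
  moreover have "(matrix_inv M *v axis j 1) $ i = matrix_inv M $ i $ j"
    by (simp add: matrix_vector_mul_component inner_axis)
  ultimately show ?thesis
    by (simp add: axis_def cong: if_cong)
qed

lemma Ck_on_det:
  assumes "open S" "\<And>i j. Ck_on k S (\<lambda>x. M x $ i $ j)"
  shows "Ck_on k S (\<lambda>x. det (M x))"
  unfolding det_def by (intro Ck_on_sum Ck_on_mult Ck_on_prod Ck_on_const assms)

lemma Ck_on_matrix_inv:
  fixes M :: "real^'m::finite \<Rightarrow> real^'n::finite^'n"
  assumes S: "open S" and M: "\<And>i j. Ck_on k S (\<lambda>x. M x $ i $ j)" and pos: "\<And>x. x \<in> S \<Longrightarrow> det (M x) > 0"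
  shows "Ck_on k S (\<lambda>x. matrix_inv (M x) $ i $ j)"
proof (rule Ck_on_cong[OF S])
  let ?N = "\<lambda>x. det (\<chi> r s. if s = i then (if r = j then 1 else 0) else M x $ r $ s)"
  show "?N x * det (M x) powr (- 1) = matrix_inv (M x) $ i $ j" if "x \<in> S" for x
    using pos[OF that] by (simp add: matrix_inv_cramer powr_neg_one divide_inverse)
  have "Ck_on k S (\<lambda>x. (\<chi> r s. if s = i then (if r = j then 1 else 0) else M x $ r $ s) $ a $ b)" for a b
    by (cases "b = i") (use M in \<open>simp_all add: Ck_on_const[OF S]\<close>)
  then show "Ck_on k S (\<lambda>x. ?N x * det (M x) powr (- 1))"
    by (intro Ck_on_mult Ck_on_powr Ck_on_det S M pos)
qed

lemma Ck_on_sqrt_det: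
  fixes M :: "real^'m::finite \<Rightarrow> real^'n::finite^'n"
  assumes S: "open S" and M: "\<And>i j. Ck_on k S (\<lambda>x. M x $ i $ j)" and pos: "\<And>x. x \<in> S \<Longrightarrow> det (M x) > 0"
  shows "Ck_on k S (\<lambda>x. sqrt (det (M x)))"
proof (rule Ck_on_cong[OF S])
  show "det (M x) powr (1/2) = sqrt (det (M x))" if "x \<in> S" for x
    using pos[OF that] by (simp add: powr_half_sqrt)
qed (intro Ck_on_powr Ck_on_det S M pos)

section \<open>The Laplace operator of a metric in coordinates\<close>

definition coord_laplacian :: "(real^'n::finite \<Rightarrow> real^'n^'n) \<Rightarrow> (real^'n \<Rightarrow> real) \<Rightarrow> real^'n \<Rightarrow> real" where
  "coord_laplacian H f x = 1 / sqrt (det (H x)) *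
     (\<Sum>i\<in>UNIV. \<Sum>j\<in>UNIV.
        partial_deriv i (\<lambda>y. matrix_inv (H y) $ i $ j * sqrt (det (H y)) * partial_deriv j f y) x)"

lemma laplacian_coord:
  "laplacian A g c f p = coord_laplacian (metric_matrix A g c) (f \<circ> chart_inv c) (snd c p)"
  by (simp add: laplacian_def coord_laplacian_def Let_def)

lemma coord_laplacian_cong:
  assumes S: "open S" "x \<in> S" and H: "\<And>y. y \<in> S \<Longrightarrow> H y = H' y" and f: "\<And>y. y \<in> S \<Longrightarrow> f y = f' y"
  shows "coord_laplacian H f x = coord_laplacian H' f' x"
proof -
  have "partial_deriv i (\<lambda>y. matrix_inv (H y) $ i $ j * sqrt (det (H y)) * partial_deriv j f y) x =
    partial_deriv i (\<lambda>y. matrix_inv (H' y) $ i $ j * sqrt (det (H' y)) * partial_deriv j f' y) x" for i j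
  proof (rule partial_deriv_cong[OF S])
    fix y assume y: "y \<in> S"
    have "partial_deriv j f y = partial_deriv j f' y"
      by (rule partial_deriv_cong[OF S(1) y f])
    then show "matrix_inv (H y) $ i $ j * sqrt (det (H y)) * partial_deriv j f y
      = matrix_inv (H' y) $ i $ j * sqrt (det (H' y)) * partial_deriv j f' y"
      by (simp add: H[OF y])
  qed
  then show ?thesis
    by (simp add: coord_laplacian_def H[OF S(2)])
qed

locale coord_metric =
  fixes S :: "(real^'n::finite) set" and H :: "real^'n \<Rightarrow> real^'n^'n"
  assumes open_S: "open S"
    and smooth_H: "\<And>i j. smooth_on S (\<lambda>x. H x $ i $ j)"
    and det_pos: "\<And>x. x \<in> S \<Longrightarrow> det (H x) > 0"
begin

lemma Ck_weight: "Ck_on k S (\<lambda>x. matrix_inv (H x) $ i $ j * sqrt (det (H x)))"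
  by (intro Ck_on_mult Ck_on_matrix_inv Ck_on_sqrt_det open_S smooth_onD smooth_H det_pos)

lemma Ck_flux:
  assumes "Ck_on (Suc k) S f"
  shows "Ck_on k S (\<lambda>x. matrix_inv (H x) $ i $ j * sqrt (det (H x)) * partial_deriv j f x)"
  using assms by (intro Ck_on_mult Ck_weight open_S) simp

lemma continuous_coord_laplacian:
  assumes "Ck_on 2 S f"
  shows "continuous_on S (coord_laplacian H f)"
proof -
  have "continuous_on S (\<lambda>x. partial_deriv i
      (\<lambda>y. matrix_inv (H y) $ i $ j * sqrt (det (H y)) * partial_deriv j f y) x)" for i j
    using Ck_flux[of "Suc 0" f i j] assms by (simp add: numeral_2_eq_2)
  moreover have "continuous_on S (\<lambda>x. sqrt (det (H x)))"
    using Ck_on_sqrt_det[OF open_S, of 0 H] smooth_H det_pos by (auto simp: smooth_on_def simp flip: Ck_on.simps(1))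
  moreover have "sqrt (det (H x)) \<noteq> 0" if "x \<in> S" for x
    using det_pos[OF that] by simp
  ultimately show ?thesis
    unfolding coord_laplacian_def by (auto intro!: continuous_intros)
qed

lemma coord_laplacian_add_cmult:
  assumes "Ck_on 2 S f" "Ck_on 2 S h" and x: "x \<in> S"
  shows "coord_laplacian H (\<lambda>y. f y + a * h y) x = coord_laplacian H f x + a * coord_laplacian H h x"
proof -
  let ?w = "\<lambda>i j y. matrix_inv (H y) $ i $ j * sqrt (det (H y))"
  have C: "Ck_on (Suc (Suc 0)) S f" "Ck_on (Suc (Suc 0)) S h"
    using assms by (simp_all add: numeral_2_eq_2)
  have d: "f differentiable (at y)" "h differentiable (at y)" "(\<lambda>z. a * h z) differentiable (at y)" if "y \<in> S" for y
    using that Ck_on_differentiable[OF C(1) open_S] Ck_on_differentiable[OF C(2) open_S] by auto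
  have df: "(\<lambda>y. ?w i j y * partial_deriv j f y) differentiable (at x)"
       "(\<lambda>y. ?w i j y * partial_deriv j h y) differentiable (at x)" for i j
    using Ck_on_differentiable[OF Ck_flux[OF C(1)] open_S x] Ck_on_differentiable[OF Ck_flux[OF C(2)] open_S x]
    by blast+
  have "partial_deriv i (\<lambda>y. ?w i j y * partial_deriv j (\<lambda>y. f y + a * h y) y) x =
     partial_deriv i (\<lambda>y. ?w i j y * partial_deriv j f y) x + a * partial_deriv i (\<lambda>y. ?w i j y * partial_deriv j h y) x" for i j
  proof -
    have "partial_deriv i (\<lambda>y. ?w i j y * partial_deriv j (\<lambda>y. f y + a * h y) y) x =
       partial_deriv i (\<lambda>y. ?w i j y * partial_deriv j f y + a * (?w i j y * partial_deriv j h y)) x"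
      by (rule partial_deriv_cong[OF open_S x])
         (simp add: partial_deriv_add partial_deriv_cmult d algebra_simps)
    also have "\<dots> = partial_deriv i (\<lambda>y. ?w i j y * partial_deriv j f y) x + a * partial_deriv i (\<lambda>y. ?w i j y * partial_deriv j h y) x"
      using df[of i j] by (simp add: partial_deriv_add partial_deriv_cmult)
    finally show ?thesis .
  qed
  then show ?thesis
    by (simp add: coord_laplacian_def sum.distrib sum_distrib_left algebra_simps)
qed

end

subsection \<open>Change of coordinates\<close>

lemma abs_has_real_derivative:
  assumes "t \<noteq> (0::real)"
  shows "(abs has_real_derivative sgn t) (at t)"
proof (rule has_field_derivative_transform_within_open)
  show "((\<lambda>u. sgn t * u) has_real_derivative sgn t) (at t)"
    by (auto intro!: derivative_eq_intros)
  show "open (if t > 0 then {0::real<..} else {..<0})" "t \<in> (if t > 0 then {0::real<..} else {..<0})"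
    using assms by auto
  show "sgn t * u = \<bar>u\<bar>" if "u \<in> (if t > 0 then {0::real<..} else {..<0})" for u
    using that assms by (auto split: if_splits)
qed

text \<open>
  The inverse \<open>\<psi>\<close> is part of the data because its partial derivatives, taken at \<open>\<phi> x\<close>, give
  the inverse Jacobian matrix \<open>K\<close> as a matrix that is visibly smooth.
\<close>

locale coord_change =
  fixes U V :: "(real^'n::finite) set" and \<phi> \<psi> :: "real^'n \<Rightarrow> real^'n"
  assumes open_U: "open U" and open_V: "open V"
    and \<phi>_in: "\<And>x. x \<in> U \<Longrightarrow> \<phi> x \<in> V"
    and \<psi>_\<phi>: "\<And>x. x \<in> U \<Longrightarrow> \<psi> (\<phi> x) = x"
    and smooth_\<phi>: "\<And>i. smooth_on U (\<lambda>x. \<phi> x $ i)"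
    and smooth_\<psi>: "\<And>i. smooth_on V (\<lambda>y. \<psi> y $ i)"
begin

definition J :: "real^'n \<Rightarrow> real^'n^'n" where
  "J x = (\<chi> a b. partial_deriv b (\<lambda>y. \<phi> y $ a) x)"

definition K :: "real^'n \<Rightarrow> real^'n^'n" where
  "K x = (\<chi> a b. partial_deriv b (\<lambda>y. \<psi> y $ a) (\<phi> x))"

lemma d_\<phi>: "x \<in> U \<Longrightarrow> (\<lambda>y. \<phi> y $ i) differentiable (at x)"
  using smooth_on_differentiable[OF smooth_\<phi> open_U] .

lemma d_\<psi>: "x \<in> V \<Longrightarrow> (\<lambda>y. \<psi> y $ i) differentiable (at x)"
  using smooth_on_differentiable[OF smooth_\<psi> open_V] .

lemma Ck_J: "Ck_on k U (\<lambda>x. J x $ a $ b)"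
  by (simp add: J_def smooth_onD smooth_on_partial smooth_\<phi>)

lemma Ck_K: "Ck_on k U (\<lambda>x. K x $ a $ b)"
proof -
  have "Ck_on k U (\<lambda>x. partial_deriv b (\<lambda>y. \<psi> y $ a) (\<phi> x))"
    by (rule Ck_on_compose[OF open_U open_V])
       (auto simp: \<phi>_in smooth_onD smooth_on_partial smooth_\<phi> smooth_\<psi>)
  then show ?thesis by (simp add: K_def)
qed

lemma d_J: "x \<in> U \<Longrightarrow> (\<lambda>x. J x $ a $ b) differentiable (at x)"
  and d_K: "x \<in> U \<Longrightarrow> (\<lambda>x. K x $ a $ b) differentiable (at x)"
  using Ck_on_differentiable[OF Ck_J open_U] Ck_on_differentiable[OF Ck_K open_U] by auto

lemma K_J: assumes x: "x \<in> U" shows "K x ** J x = mat 1"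
proof -
  have coord: "((\<lambda>x::real^'n. x $ a) has_derivative (\<lambda>h. h $ a)) (at x)" for a
    by (rule bounded_linear_imp_has_derivative[OF bounded_linear_vec_nth])
  have "(\<Sum>l\<in>UNIV. K x $ a $ l * J x $ l $ b) = (if a = b then 1 else 0)" for a b
  proof -
    have "(\<Sum>l\<in>UNIV. K x $ a $ l * J x $ l $ b) = partial_deriv b (\<lambda>y. \<psi> (\<phi> y) $ a) x"
      using partial_deriv_chain[OF d_\<psi>[OF \<phi>_in[OF x]] d_\<phi>[OF x], of b a]
      by (simp add: J_def K_def mult.commute)
    also have "\<dots> = partial_deriv b (\<lambda>y. y $ a) x"
      by (rule partial_deriv_cong[OF open_U x]) (simp add: \<psi>_\<phi>)
    also have "\<dots> = (if a = b then 1 else 0)"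
      by (simp add: partial_deriv_eq[OF coord] axis_def)
    finally show ?thesis .
  qed
  then show ?thesis
    by (simp add: matrix_matrix_mult_def mat_def vec_eq_iff)
qed

lemma J_K: "x \<in> U \<Longrightarrow> J x ** K x = mat 1"
  using K_J matrix_left_right_inverse by blast

lemma J_K_sum: "x \<in> U \<Longrightarrow> (\<Sum>l\<in>UNIV. J x $ a $ l * K x $ l $ b) = (if a = b then 1 else 0)"
  and K_J_sum: "x \<in> U \<Longrightarrow> (\<Sum>l\<in>UNIV. K x $ a $ l * J x $ l $ b) = (if a = b then 1 else 0)"
  using J_K[of x] K_J[of x] by (simp_all add: matrix_matrix_mult_def mat_def vec_eq_iff)

lemma det_J: assumes "x \<in> U" shows "det (J x) \<noteq> 0"
  using J_K[OF assms] by (metis invertible_det_nz invertible_right_inverse)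

lemma partial_J_commute:
  assumes "x \<in> U"
  shows "partial_deriv i (\<lambda>y. J y $ a $ b) x = partial_deriv b (\<lambda>y. J y $ a $ i) x"
  using partial_deriv_commute[OF open_U smooth_onD[OF smooth_\<phi>] assms, of i b a]
  by (simp add: J_def)

lemma partial_abs_det_J:
  assumes x: "x \<in> U"
  shows "partial_deriv i (\<lambda>y. \<bar>det (J y)\<bar>) x =
      (\<Sum>a\<in>UNIV. \<Sum>b\<in>UNIV. partial_deriv i (\<lambda>y. J y $ a $ b) x * K x $ b $ a) * \<bar>det (J x)\<bar>"
    and "(\<lambda>y. \<bar>det (J y)\<bar>) differentiable (at x)"
proof -
  note det = partial_deriv_det[OF d_J[OF x] K_J[OF x]]
  have abs: "(abs has_real_derivative sgn (det (J x))) (at (det (J x)))"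
    using det_J[OF x] by (rule abs_has_real_derivative)
  show "(\<lambda>y. \<bar>det (J y)\<bar>) differentiable (at x)"
    using partial_deriv_real_chain(2)[OF abs det(2)] .
  show "partial_deriv i (\<lambda>y. \<bar>det (J y)\<bar>) x =
      (\<Sum>a\<in>UNIV. \<Sum>b\<in>UNIV. partial_deriv i (\<lambda>y. J y $ a $ b) x * K x $ b $ a) * \<bar>det (J x)\<bar>"
    unfolding partial_deriv_real_chain(1)[OF abs det(2)] det(1) by (simp add: abs_sgn)
qed

text \<open>
  Differentiate \<open>J ** K = mat 1\<close> and multiply by \<open>K\<close> from the left.
\<close>

lemma partial_K:
  assumes x: "x \<in> U"
  shows "partial_deriv i (\<lambda>y. K y $ r $ k) x =
    - (\<Sum>a\<in>UNIV. \<Sum>l\<in>UNIV. K x $ r $ a * partial_deriv i (\<lambda>y. J y $ a $ l) x * K x $ l $ k)"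
proof -
  let ?B = "\<lambda>a l. partial_deriv i (\<lambda>y. J y $ a $ l) x" and ?E = "\<lambda>l. partial_deriv i (\<lambda>y. K y $ l $ k) x"
  have z: "(\<Sum>l\<in>UNIV. ?B a l * K x $ l $ k + J x $ a $ l * ?E l) = 0" for a
  proof -
    have "(\<Sum>l\<in>UNIV. ?B a l * K x $ l $ k + J x $ a $ l * ?E l)
        = partial_deriv i (\<lambda>y. \<Sum>l\<in>UNIV. J y $ a $ l * K y $ l $ k) x"
      by (simp add: partial_deriv_sum partial_deriv_mult d_J d_K x)
    also have "\<dots> = partial_deriv i (\<lambda>y. if a = k then 1 else 0) x"
      by (rule partial_deriv_cong[OF open_U x]) (simp add: J_K_sum)
    finally show ?thesis by (simp add: partial_deriv_const)
  qed
  have "0 = (\<Sum>a\<in>UNIV. K x $ r $ a * (\<Sum>l\<in>UNIV. ?B a l * K x $ l $ k + J x $ a $ l * ?E l))"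
    by (simp add: z)
  also have "\<dots> = (\<Sum>a\<in>UNIV. \<Sum>l\<in>UNIV. K x $ r $ a * ?B a l * K x $ l $ k)
      + (\<Sum>a\<in>UNIV. \<Sum>l\<in>UNIV. K x $ r $ a * J x $ a $ l * ?E l)"
    by (simp add: sum_distrib_left sum.distrib algebra_simps)
  also have "(\<Sum>a\<in>UNIV. \<Sum>l\<in>UNIV. K x $ r $ a * J x $ a $ l * ?E l)
      = (\<Sum>l\<in>UNIV. (\<Sum>a\<in>UNIV. K x $ r $ a * J x $ a $ l) * ?E l)"
    by (subst sum.swap) (simp add: sum_distrib_right)
  also have "\<dots> = ?E r"
    by (simp add: K_J_sum[OF x] if_distrib[where f="\<lambda>u. u * _"] cong: if_cong)
  finally show ?thesis by linarith
qed

text \<open>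
  The Piola identity. By Jacobi's formula and the derivative of the inverse, both contributions are
  triple sums of \<open>K\<close>, \<open>K\<close> and second derivatives of \<open>\<phi>\<close>; they differ only in the order of the two
  differentiations.
\<close>

lemma piola:
  assumes x: "x \<in> U"
  shows "(\<Sum>i\<in>UNIV. partial_deriv i (\<lambda>y. \<bar>det (J y)\<bar> * K y $ i $ k) x) = 0"
proof -
  let ?B = "\<lambda>i a l. partial_deriv i (\<lambda>y. J y $ a $ l) x" and ?D = "\<bar>det (J x)\<bar>"
  have "partial_deriv i (\<lambda>y. \<bar>det (J y)\<bar> * K y $ i $ k) x
     = ?D * (\<Sum>a\<in>UNIV. \<Sum>b\<in>UNIV. ?B i a b * K x $ b $ a * K x $ i $ k)
     - ?D * (\<Sum>a\<in>UNIV. \<Sum>l\<in>UNIV. K x $ i $ a * ?B i a l * K x $ l $ k)" for i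
    by (simp add: partial_deriv_mult partial_abs_det_J x d_K partial_K sum_distrib_right sum_distrib_left algebra_simps)
  then have "(\<Sum>i\<in>UNIV. partial_deriv i (\<lambda>y. \<bar>det (J y)\<bar> * K y $ i $ k) x) =
     ?D * (\<Sum>i\<in>UNIV. \<Sum>a\<in>UNIV. \<Sum>b\<in>UNIV. ?B i a b * K x $ b $ a * K x $ i $ k)
     - ?D * (\<Sum>i\<in>UNIV. \<Sum>a\<in>UNIV. \<Sum>l\<in>UNIV. K x $ i $ a * ?B i a l * K x $ l $ k)"
    by (simp add: sum_subtractf sum_distrib_left)
  also have "(\<Sum>i\<in>UNIV. \<Sum>a\<in>UNIV. \<Sum>l\<in>UNIV. K x $ i $ a * ?B i a l * K x $ l $ k)
      = (\<Sum>i\<in>UNIV. \<Sum>l\<in>UNIV. \<Sum>a\<in>UNIV. K x $ i $ a * ?B i a l * K x $ l $ k)"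
    by (rule sum.cong[OF refl], rule sum.swap)
  also have "\<dots> = (\<Sum>l\<in>UNIV. \<Sum>i\<in>UNIV. \<Sum>a\<in>UNIV. K x $ i $ a * ?B i a l * K x $ l $ k)"
    by (rule sum.swap)
  also have "\<dots> = (\<Sum>l\<in>UNIV. \<Sum>a\<in>UNIV. \<Sum>i\<in>UNIV. K x $ i $ a * ?B i a l * K x $ l $ k)"
    by (rule sum.cong[OF refl], rule sum.swap)
  also have "\<dots> = (\<Sum>l\<in>UNIV. \<Sum>a\<in>UNIV. \<Sum>i\<in>UNIV. ?B l a i * K x $ i $ a * K x $ l $ k)"
    by (subst partial_J_commute[OF x]) (simp add: mult_ac)
  finally show ?thesis by simp
qed

text \<open>
  The derivative that falls on \<open>|det J| K\<close> disappears by the Piola identity; in the other one the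
  chain rule produces \<open>J ** K\<close>.
\<close>

lemma divergence_change:
  assumes x: "x \<in> U" and X: "\<And>k. X k differentiable (at (\<phi> x))"
  shows "(\<Sum>i\<in>UNIV. partial_deriv i (\<lambda>y. \<Sum>k\<in>UNIV. \<bar>det (J y)\<bar> * K y $ i $ k * X k (\<phi> y)) x)
    = \<bar>det (J x)\<bar> * (\<Sum>k\<in>UNIV. partial_deriv k (X k) (\<phi> x))"
proof -
  let ?D = "\<bar>det (J x)\<bar>"
  have dX: "(\<lambda>y. X k (\<phi> y)) differentiable (at x)" for k
    using has_derivative_chain[OF X d_\<phi>[OF x], of k] differentiable_def by blast
  have dDK: "(\<lambda>y. \<bar>det (J y)\<bar> * K y $ i $ k) differentiable (at x)" for i k
    by (intro differentiable_mult partial_abs_det_J d_K x)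
  have pX: "partial_deriv i (\<lambda>y. X k (\<phi> y)) x = (\<Sum>j\<in>UNIV. J x $ j $ i * partial_deriv j (X k) (\<phi> x))" for i k
    using partial_deriv_chain[OF X d_\<phi>[OF x]] by (simp add: J_def)
  have "(\<Sum>i\<in>UNIV. partial_deriv i (\<lambda>y. \<Sum>k\<in>UNIV. \<bar>det (J y)\<bar> * K y $ i $ k * X k (\<phi> y)) x)
    = (\<Sum>i\<in>UNIV. \<Sum>k\<in>UNIV. partial_deriv i (\<lambda>y. \<bar>det (J y)\<bar> * K y $ i $ k) x * X k (\<phi> x)
        + ?D * K x $ i $ k * partial_deriv i (\<lambda>y. X k (\<phi> y)) x)"
  proof (rule sum.cong[OF refl])
    fix i
    show "partial_deriv i (\<lambda>y. \<Sum>k\<in>UNIV. \<bar>det (J y)\<bar> * K y $ i $ k * X k (\<phi> y)) x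
      = (\<Sum>k\<in>UNIV. partial_deriv i (\<lambda>y. \<bar>det (J y)\<bar> * K y $ i $ k) x * X k (\<phi> x)
        + ?D * K x $ i $ k * partial_deriv i (\<lambda>y. X k (\<phi> y)) x)"
      by (subst partial_deriv_sum) (intro differentiable_mult dDK dX, subst partial_deriv_mult[OF dDK dX], rule refl)
  qed
  also have "\<dots> = (\<Sum>k\<in>UNIV. (\<Sum>i\<in>UNIV. partial_deriv i (\<lambda>y. \<bar>det (J y)\<bar> * K y $ i $ k) x) * X k (\<phi> x))
     + (\<Sum>k\<in>UNIV. \<Sum>i\<in>UNIV. ?D * K x $ i $ k * partial_deriv i (\<lambda>y. X k (\<phi> y)) x)"
    by (subst sum.swap) (simp add: sum.distrib sum_distrib_right)
  also have "\<dots> = (\<Sum>k\<in>UNIV. \<Sum>i\<in>UNIV. \<Sum>j\<in>UNIV. ?D * partial_deriv j (X k) (\<phi> x) * (J x $ j $ i * K x $ i $ k))"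
    by (simp add: piola[OF x] pX sum_distrib_left mult_ac)
  also have "\<dots> = (\<Sum>k\<in>UNIV. \<Sum>j\<in>UNIV. \<Sum>i\<in>UNIV. ?D * partial_deriv j (X k) (\<phi> x) * (J x $ j $ i * K x $ i $ k))"
    by (rule sum.cong[OF refl], rule sum.swap)
  also have "\<dots> = (\<Sum>k\<in>UNIV. \<Sum>j\<in>UNIV. ?D * partial_deriv j (X k) (\<phi> x) * (if j = k then 1 else 0))"
    by (simp only: J_K_sum[OF x] flip: sum_distrib_left)
  also have "\<dots> = ?D * (\<Sum>k\<in>UNIV. partial_deriv k (X k) (\<phi> x))"
    by (simp add: sum_distrib_left if_distrib[where f="\<lambda>u. _ * u"] cong: if_cong)
  finally show ?thesis .
qed

text \<open>
  If \<open>G\<close> is the pullback of \<open>H\<close>, then \<open>G\<inverse> = K H\<inverse> K\<^sup>T\<close> and \<open>\<surd>det G = |det J| \<surd>det H\<close>, so the flux of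
  \<open>F \<circ> \<phi>\<close> is \<open>|det J| K\<close> applied to the flux of \<open>F\<close>, and the rule for divergences applies.
\<close>

lemma coord_laplacian_change:
  assumes x: "x \<in> U" and H: "coord_metric V H" and F: "Ck_on 2 V F"
    and G: "\<And>y. y \<in> U \<Longrightarrow> G y = transpose (J y) ** H (\<phi> y) ** J y"
  shows "coord_laplacian G (\<lambda>y. F (\<phi> y)) x = coord_laplacian H F (\<phi> x)"
proof -
  interpret H: coord_metric V H by (rule H)
  have F2: "Ck_on (Suc (Suc 0)) V F" using F by (simp add: numeral_2_eq_2)
  have dF: "F differentiable (at (\<phi> y))" if "y \<in> U" for y
    using Ck_on_differentiable[OF F2 open_V \<phi>_in[OF that]] .
  define flux where "flux k m z = matrix_inv (H z) $ k $ m * sqrt (det (H z)) * partial_deriv m F z" for k m z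
  define X where "X k z = (\<Sum>m\<in>UNIV. flux k m z)" for k z
  have dflux: "flux k m differentiable (at z)" if "z \<in> V" for k m z
    unfolding flux_def using Ck_on_differentiable[OF H.Ck_flux[OF F2] open_V that] .
  have dX: "X k differentiable (at z)" if "z \<in> V" for k z
    unfolding X_def using dflux[OF that] by (intro differentiable_sum) auto
  have detG: "det (G y) = det (J y) * det (J y) * det (H (\<phi> y))" if "y \<in> U" for y
    by (simp add: G[OF that] det_mul)
  have invG: "matrix_inv (G y) = K y ** matrix_inv (H (\<phi> y)) ** transpose (K y)" if y: "y \<in> U" for y
  proof (rule matrix_inv_eqI)
    have "det (H (\<phi> y)) \<noteq> 0" using H.det_pos[OF \<phi>_in[OF y]] by simp
    then have 1: "H (\<phi> y) ** matrix_inv (H (\<phi> y)) = mat 1" by (rule matrix_inv_works)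
    have "G y ** (K y ** matrix_inv (H (\<phi> y)) ** transpose (K y))
      = transpose (J y) ** (H (\<phi> y) ** ((J y ** K y) ** matrix_inv (H (\<phi> y)))) ** transpose (K y)"
      by (simp add: G[OF y] matrix_mul_assoc)
    also have "\<dots> = transpose (K y ** J y)"
      by (simp add: J_K[OF y] 1 matrix_transpose_mul)
    finally show "G y ** (K y ** matrix_inv (H (\<phi> y)) ** transpose (K y)) = mat 1"
      by (simp add: K_J[OF y] transpose_mat)
  qed
  have main: "(\<Sum>j\<in>UNIV. matrix_inv (G y) $ i $ j * sqrt (det (G y)) * partial_deriv j (\<lambda>y. F (\<phi> y)) y)
      = (\<Sum>k\<in>UNIV. \<bar>det (J y)\<bar> * K y $ i $ k * X k (\<phi> y))" if y: "y \<in> U" for y i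
  proof -
    let ?h = "matrix_inv (H (\<phi> y))" and ?s = "sqrt (det (H (\<phi> y)))"
    have pF: "partial_deriv j (\<lambda>y. F (\<phi> y)) y = (\<Sum>l\<in>UNIV. J y $ l $ j * partial_deriv l F (\<phi> y))" for j
      using partial_deriv_chain[OF dF[OF y] d_\<phi>[OF y]] by (simp add: J_def)
    have cancel: "(\<Sum>j\<in>UNIV. K y $ j $ m * partial_deriv j (\<lambda>y. F (\<phi> y)) y) = partial_deriv m F (\<phi> y)" for m
    proof -
      have "(\<Sum>j\<in>UNIV. K y $ j $ m * partial_deriv j (\<lambda>y. F (\<phi> y)) y)
        = (\<Sum>j\<in>UNIV. \<Sum>l\<in>UNIV. J y $ l $ j * K y $ j $ m * partial_deriv l F (\<phi> y))"
        by (simp add: pF sum_distrib_left mult_ac)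
      also have "\<dots> = (\<Sum>l\<in>UNIV. (\<Sum>j\<in>UNIV. J y $ l $ j * K y $ j $ m) * partial_deriv l F (\<phi> y))"
        by (subst sum.swap) (simp add: sum_distrib_right)
      finally show ?thesis
        by (simp add: J_K_sum[OF y] if_distrib[where f="\<lambda>u. u * _"] cong: if_cong)
    qed
    have inv: "matrix_inv (G y) $ i $ j = (\<Sum>m\<in>UNIV. \<Sum>k\<in>UNIV. K y $ i $ k * ?h $ k $ m * K y $ j $ m)" for j
      by (simp add: invG[OF y] matrix_matrix_mult_def transpose_def sum_distrib_right)
    have sq: "sqrt (det (G y)) = \<bar>det (J y)\<bar> * ?s"
      by (simp add: detG[OF y] real_sqrt_mult)
    have "(\<Sum>j\<in>UNIV. matrix_inv (G y) $ i $ j * sqrt (det (G y)) * partial_deriv j (\<lambda>y. F (\<phi> y)) y)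
      = (\<Sum>j\<in>UNIV. \<Sum>m\<in>UNIV. \<Sum>k\<in>UNIV. \<bar>det (J y)\<bar> * K y $ i $ k * (?h $ k $ m * ?s) * (K y $ j $ m * partial_deriv j (\<lambda>y. F (\<phi> y)) y))"
      by (simp add: inv sq sum_distrib_right sum_distrib_left mult_ac)
    also have "\<dots> = (\<Sum>m\<in>UNIV. \<Sum>j\<in>UNIV. \<Sum>k\<in>UNIV. \<bar>det (J y)\<bar> * K y $ i $ k * (?h $ k $ m * ?s) * (K y $ j $ m * partial_deriv j (\<lambda>y. F (\<phi> y)) y))"
      by (rule sum.swap)
    also have "\<dots> = (\<Sum>m\<in>UNIV. \<Sum>k\<in>UNIV. \<Sum>j\<in>UNIV. \<bar>det (J y)\<bar> * K y $ i $ k * (?h $ k $ m * ?s) * (K y $ j $ m * partial_deriv j (\<lambda>y. F (\<phi> y)) y))"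
      by (rule sum.cong[OF refl], rule sum.swap)
    also have "\<dots> = (\<Sum>m\<in>UNIV. \<Sum>k\<in>UNIV. \<bar>det (J y)\<bar> * K y $ i $ k * (?h $ k $ m * ?s) * partial_deriv m F (\<phi> y))"
      by (simp only: cancel flip: sum_distrib_left)
    also have "\<dots> = (\<Sum>k\<in>UNIV. \<bar>det (J y)\<bar> * K y $ i $ k * X k (\<phi> y))"
      by (subst sum.swap) (simp add: X_def flux_def sum_distrib_left mult_ac)
    finally show ?thesis .
  qed
  have dK: "(\<lambda>y. \<Sum>k\<in>UNIV. \<bar>det (J y)\<bar> * K y $ i $ k * X k (\<phi> y)) differentiable (at x)" for i
  proof (intro differentiable_sum differentiable_mult partial_abs_det_J d_K x finite ballI)
    show "(\<lambda>y. X k (\<phi> y)) differentiable (at x)" for k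
      using has_derivative_chain[OF dX[OF \<phi>_in[OF x]] d_\<phi>[OF x], of k] differentiable_def by blast
  qed
  have CG: "Ck_on 1 U (\<lambda>y. G y $ i $ j)" for i j
  proof (rule Ck_on_cong[OF open_U])
    show "(\<Sum>l\<in>UNIV. \<Sum>k\<in>UNIV. J y $ k $ i * H (\<phi> y) $ k $ l * J y $ l $ j) = G y $ i $ j" if "y \<in> U" for y
      by (simp add: G[OF that] matrix_matrix_mult_def transpose_def sum_distrib_right)
    have "Ck_on 1 U (\<lambda>y. H (\<phi> y) $ k $ l)" for k l
      by (rule Ck_on_compose[OF open_U open_V, where f = "\<lambda>y. H y $ k $ l"])
         (auto intro: \<phi>_in smooth_onD smooth_\<phi> H.smooth_H simp del: Ck_on.simps One_nat_def)
    then show "Ck_on 1 U (\<lambda>y. \<Sum>l\<in>UNIV. \<Sum>k\<in>UNIV. J y $ k $ i * H (\<phi> y) $ k $ l * J y $ l $ j)"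
      by (intro Ck_on_sum Ck_on_mult open_U Ck_J)
  qed
  have posG: "det (G y) > 0" if "y \<in> U" for y
    using det_J[OF that] H.det_pos[OF \<phi>_in[OF that]] by (auto simp: detG[OF that] zero_less_mult_iff linorder_neq_iff)
  have CF: "Ck_on 1 U (partial_deriv j (\<lambda>y. F (\<phi> y)))" for j
  proof -
    have "Ck_on 2 U (\<lambda>y. F (\<phi> y))"
      by (rule Ck_on_compose[OF open_U open_V]) (auto intro: \<phi>_in smooth_onD smooth_\<phi> F simp del: Ck_on.simps)
    then show ?thesis by (simp add: numeral_2_eq_2)
  qed
  have dG: "(\<lambda>y. matrix_inv (G y) $ i $ j * sqrt (det (G y)) * partial_deriv j (\<lambda>y. F (\<phi> y)) y) differentiable (at x)" for i j
  proof -
    have "Ck_on 1 U (\<lambda>y. matrix_inv (G y) $ i $ j * sqrt (det (G y)) * partial_deriv j (\<lambda>y. F (\<phi> y)) y)"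
      by (intro Ck_on_mult Ck_on_matrix_inv Ck_on_sqrt_det open_U CG posG CF)
    then show ?thesis
      by (intro Ck_on_differentiable[OF _ open_U x, of 0]) simp
  qed
  have "(\<Sum>i\<in>UNIV. \<Sum>j\<in>UNIV. partial_deriv i (\<lambda>y. matrix_inv (G y) $ i $ j * sqrt (det (G y)) * partial_deriv j (\<lambda>y. F (\<phi> y)) y) x)
    = (\<Sum>i\<in>UNIV. partial_deriv i (\<lambda>y. \<Sum>j\<in>UNIV. matrix_inv (G y) $ i $ j * sqrt (det (G y)) * partial_deriv j (\<lambda>y. F (\<phi> y)) y) x)"
    by (simp add: partial_deriv_sum[OF dG])
  also have "\<dots> = (\<Sum>i\<in>UNIV. partial_deriv i (\<lambda>y. \<Sum>k\<in>UNIV. \<bar>det (J y)\<bar> * K y $ i $ k * X k (\<phi> y)) x)"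
    by (rule sum.cong[OF refl], rule partial_deriv_cong[OF open_U x main])
  also have "\<dots> = \<bar>det (J x)\<bar> * (\<Sum>k\<in>UNIV. partial_deriv k (X k) (\<phi> x))"
    by (rule divergence_change[OF x dX[OF \<phi>_in[OF x]]])
  also have "(\<Sum>k\<in>UNIV. partial_deriv k (X k) (\<phi> x)) = (\<Sum>k\<in>UNIV. \<Sum>m\<in>UNIV. partial_deriv k (flux k m) (\<phi> x))"
    unfolding X_def by (simp add: partial_deriv_sum dflux[OF \<phi>_in[OF x]])
  finally show ?thesis
    using det_J[OF x] by (simp add: coord_laplacian_def flux_def[abs_def] detG[OF x] real_sqrt_mult)
qed

end

section \<open>Positive definite matrices\<close>

definition posdef :: "real^'n::finite^'n \<Rightarrow> bool" where
  "posdef M \<longleftrightarrow> (\<forall>v. v \<noteq> 0 \<longrightarrow> v \<bullet> (M *v v) > 0)"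

lemma posdef_det_nz:
  assumes "posdef M"
  shows "det M \<noteq> 0"
proof
  assume "det M = 0"
  then obtain v where "v \<noteq> 0" "M *v v = 0"
    by (metis invertible_det_nz invertible_left_inverse matrix_left_invertible_ker)
  then show False using assms by (auto simp: posdef_def)
qed

text \<open>
  The segment from the identity to \<open>M\<close> consists of positive definite, hence nonsingular, matrices,
  so the determinant keeps the sign that it has at the identity.
\<close>

lemma posdef_det_pos:
  fixes M :: "real^'n::finite^'n"
  assumes "posdef M"
  shows "det M > 0"
proof (rule ccontr)
  define L :: "real \<Rightarrow> real^'n^'n" where "L t = (1 - t) *\<^sub>R mat 1 + t *\<^sub>R M" for t
  assume "\<not> det M > 0"
  then have "det (L 1) \<le> 0" by (simp add: L_def)
  moreover have "0 \<le> det (L 0)" by (simp add: L_def)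
  moreover have "continuous_on {0..1} (\<lambda>t. det (L t))"
    unfolding det_def L_def by (simp, intro continuous_intros)
  ultimately obtain t where t: "0 \<le> t" "t \<le> 1" "det (L t) = 0"
    using IVT2'[of "\<lambda>t. det (L t)" 1 0 0] by auto
  have "posdef (L t)"
    unfolding posdef_def
  proof (intro allI impI)
    fix v :: "real^'n" assume v: "v \<noteq> 0"
    have e: "v \<bullet> (L t *v v) = (1 - t) * (v \<bullet> v) + t * (v \<bullet> (M *v v))"
      by (simp add: L_def matrix_vector_mult_add_rdistrib inner_add_right flip: scaleR_matrix_vector_assoc)
    have "v \<bullet> v > 0" "v \<bullet> (M *v v) > 0" using v assms by (auto simp: posdef_def)
    then show "v \<bullet> (L t *v v) > 0"
      unfolding e using t by (cases "t = 0") (auto intro!: add_nonneg_pos)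
  qed
  then show False using posdef_det_nz t(3) by blast
qed

lemma posdef_matrix_inv:
  fixes M :: "real^'n::finite^'n"
  assumes "posdef M"
  shows "posdef (matrix_inv M)"
  unfolding posdef_def
proof (intro allI impI)
  fix v :: "real^'n" assume v: "v \<noteq> 0"
  define w where "w = matrix_inv M *v v"
  have "M *v w = v"
    by (simp add: w_def matrix_vector_mul_assoc matrix_inv_works(1)[OF posdef_det_nz[OF assms]])
  moreover from this v have "w \<noteq> 0" by auto
  ultimately show "v \<bullet> (matrix_inv M *v v) > 0"
    using assms unfolding posdef_def w_def[symmetric] by (metis inner_commute)
qed

lemma inner_matrix_sum:
  fixes M :: "real^'n::finite^'n"
  shows "v \<bullet> (M *v v) = (\<Sum>i\<in>UNIV. \<Sum>j\<in>UNIV. M $ i $ j * v $ i * v $ j)"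
  by (simp add: inner_vec_def matrix_vector_mult_def sum_distrib_left mult_ac)

section \<open>A local barrier function\<close>

definition depth :: "real^'n::finite \<Rightarrow> real \<Rightarrow> real^'n \<Rightarrow> real" where
  "depth x0 R y = R\<^sup>2 - (norm (y - x0))\<^sup>2"

lemma partial_deriv_depth: "partial_deriv i (depth x0 R) y = - 2 * (y - x0) $ i"
proof -
  have "((\<lambda>y. R\<^sup>2 - (y - x0) \<bullet> (y - x0)) has_derivative (\<lambda>h. - 2 * ((y - x0) \<bullet> h))) (at y)"
    by (auto intro!: derivative_eq_intros simp: inner_commute)
  then have "(depth x0 R has_derivative (\<lambda>h. - 2 * ((y - x0) \<bullet> h))) (at y)"
    by (simp add: depth_def[abs_def] power2_norm_eq_inner)
  from partial_deriv_eq[OF this, of i] show ?thesis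
    by (simp add: inner_axis)
qed

lemma Ck_on_depth:
  assumes "open S"
  shows "Ck_on k S (depth x0 R)"
proof (rule Ck_on_cong[OF assms])
  show "R\<^sup>2 + (\<Sum>i\<in>UNIV. - 1 * ((y $ i + (- x0 $ i)) * (y $ i + (- x0 $ i)))) = depth x0 R y" for y
    by (simp add: depth_def power2_norm_eq_inner inner_vec_def sum_negf)
  show "Ck_on k S (\<lambda>y. R\<^sup>2 + (\<Sum>i\<in>UNIV. - 1 * ((y $ i + (- x0 $ i)) * (y $ i + (- x0 $ i)))))"
    by (intro Ck_on_add Ck_on_sum Ck_on_mult Ck_on_const Ck_on_coord assms)
qed

lemma Ck_on_flat_depth: "open S \<Longrightarrow> l > 0 \<Longrightarrow> Ck_on k S (\<lambda>y. flat l m (depth x0 R y))"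
  by (intro Ck_on_flat Ck_on_depth)

lemma partial_deriv_flat_depth:
  assumes "l > 0"
  shows "partial_deriv i (\<lambda>y. flat l m (depth x0 R y)) y =
    (l * flat l (m + 2) (depth x0 R y) - real m * flat l (m + 1) (depth x0 R y)) * (- 2 * (y - x0) $ i)"
proof -
  have "depth x0 R differentiable (at y)"
    using Ck_on_differentiable[OF Ck_on_depth[OF open_UNIV, of "Suc 0"] open_UNIV] by simp
  from partial_deriv_real_chain(1)[OF flat_has_derivative[OF assms] this]
  show ?thesis by (simp only: partial_deriv_depth)
qed

text \<open>
  With \<open>t\<close> the depth of \<open>x\<close>, the Laplacian of \<open>exp (- l / t)\<close> is a positive multiple of
  \<open>t\<^sup>2 P + (l - 2 t) Q\<close>, where \<open>P\<close> is the unnormalised Laplacian of the depth and \<open>Q\<close> the weighted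
  squared length of its gradient. Neither depends on \<open>l\<close>; on the compact annulus \<open>P\<close> is bounded
  below and \<open>Q\<close> has a positive minimum.
\<close>

lemma (in coord_metric) barrier:
  assumes pd: "\<And>x. x \<in> S \<Longrightarrow> posdef (H x)"
    and sub: "cball x0 R \<subseteq> S" and \<delta>: "0 < \<delta>" "\<delta> < R"
  shows "\<exists>l>0. (\<forall>x. \<delta> \<le> dist x0 x \<longrightarrow> dist x0 x < R \<longrightarrow>
      coord_laplacian H (\<lambda>y. flat l 0 (depth x0 R y)) x > 0) \<and>
    (\<forall>x\<in>S. R \<le> dist x0 x \<longrightarrow> coord_laplacian H (\<lambda>y. flat l 0 (depth x0 R y)) x = 0)"
proof -
  let ?C = "cball x0 R - ball x0 \<delta>"
  have C: "compact ?C" "?C \<subseteq> S"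
    using sub by (auto intro: compact_diff)
  have "x0 + \<delta> *\<^sub>R axis undefined 1 \<in> ?C"
    using \<delta> by (simp add: dist_norm)
  then have nonempty: "?C \<noteq> {}" by blast
  define w where "w i j y = matrix_inv (H y) $ i $ j * sqrt (det (H y))" for i j y
  define p where "p i y = - 2 * (y - x0) $ i" for i :: 'n and y
  define P where "P y = (\<Sum>i\<in>UNIV. \<Sum>j\<in>UNIV. partial_deriv i (\<lambda>z. w i j z * p j z) y)" for y
  define Q where "Q y = (\<Sum>i\<in>UNIV. \<Sum>j\<in>UNIV. w i j y * p i y * p j y)" for y
  have Cp: "Ck_on k S (p i)" for k i
  proof (rule Ck_on_cong[OF open_S])
    show "- 2 * (y $ i + - x0 $ i) = p i y" for y by (simp add: p_def)
    show "Ck_on k S (\<lambda>y. - 2 * (y $ i + - x0 $ i))"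
      by (intro Ck_on_mult Ck_on_add Ck_on_const Ck_on_coord open_S)
  qed
  have Cw: "Ck_on k S (w i j)" for k i j
    unfolding w_def[abs_def] by (rule Ck_weight)
  have Cwp: "Ck_on k S (\<lambda>z. w i j z * p j z)" for k i j
    by (intro Ck_on_mult open_S Cw Cp)
  have "Ck_on 0 S P"
    unfolding P_def using Cwp[of "Suc 0"] by (intro Ck_on_sum open_S) simp
  then have contP: "continuous_on ?C P"
    using C(2) continuous_on_subset by auto
  have "Ck_on 0 S Q"
    unfolding Q_def by (intro Ck_on_sum Ck_on_mult open_S Cw Cp)
  then have contQ: "continuous_on ?C Q"
    using C(2) continuous_on_subset by auto
  obtain a where a: "a \<in> ?C" "\<And>y. y \<in> ?C \<Longrightarrow> P a \<le> P y"
    using continuous_attains_inf[OF C(1) nonempty contP] by blast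
  obtain b where b: "b \<in> ?C" "\<And>y. y \<in> ?C \<Longrightarrow> Q b \<le> Q y"
    using continuous_attains_inf[OF C(1) nonempty contQ] by blast
  have Qpos: "Q y > 0" if "y \<in> ?C" for y
  proof -
    have yS: "y \<in> S" using that C by blast
    have "y \<noteq> x0" using that \<delta> by force
    then obtain i where "y $ i \<noteq> x0 $ i" by (auto simp: vec_eq_iff)
    then have "(\<chi> i. p i y) $ i \<noteq> 0" by (simp add: p_def)
    then have "(\<chi> i. p i y) \<noteq> 0" by (metis zero_index)
    then have "(\<chi> i. p i y) \<bullet> (matrix_inv (H y) *v (\<chi> i. p i y)) > 0"
      using posdef_matrix_inv[OF pd[OF yS]] by (auto simp: posdef_def)
    then have "sqrt (det (H y)) * ((\<chi> i. p i y) \<bullet> (matrix_inv (H y) *v (\<chi> i. p i y))) > 0"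
      using det_pos[OF yS] by simp
    also have "sqrt (det (H y)) * ((\<chi> i. p i y) \<bullet> (matrix_inv (H y) *v (\<chi> i. p i y))) = Q y"
      by (simp add: inner_matrix_sum Q_def w_def sum_distrib_left mult_ac)
    finally show ?thesis .
  qed
  \<comment> \<open>chosen so that \<open>(l - 2 t) Q\<close> exceeds \<open>t\<^sup>2 |P a|\<close> on the annulus, where \<open>t \<le> R\<^sup>2\<close>\<close>
  define l where "l = 2 * R\<^sup>2 + (R\<^sup>2 * R\<^sup>2 * \<bar>P a\<bar> + 1) / Q b"
  have Qb: "Q b > 0" using Qpos b(1) by blast
  have l: "l > 0" unfolding l_def using Qb
    by (intro add_nonneg_pos divide_pos_pos add_nonneg_pos) auto
  define F where "F m y = flat l m (depth x0 R y)" for m y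
  have formula: "(\<Sum>i\<in>UNIV. \<Sum>j\<in>UNIV. partial_deriv i (\<lambda>y. w i j y * partial_deriv j (F 0) y) x)
      = l * F 2 x * P x + l * (l * F 4 x - 2 * F 3 x) * Q x" if xS: "x \<in> S" for x
  proof -
    have Fd: "F m differentiable (at x)" for m
      using Ck_on_differentiable[OF Ck_on_flat_depth[OF open_S l, of "Suc 0"] open_S xS]
      by (simp add: F_def[abs_def])
    have pF: "partial_deriv i (F m) y = (l * F (m + 2) y - real m * F (m + 1) y) * p i y" for i m y
      using partial_deriv_flat_depth[OF l, of i m x0 R y] by (simp add: F_def[abs_def] p_def)
    have wp: "(\<lambda>z. w i j z * p j z) differentiable (at x)" for i j
      using Ck_on_differentiable[OF Cwp open_S xS] .
    have "partial_deriv i (\<lambda>y. w i j y * partial_deriv j (F 0) y) x =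
      l * F 2 x * partial_deriv i (\<lambda>z. w i j z * p j z) x
      + l * (l * F 4 x - 2 * F 3 x) * (w i j x * p i x * p j x)" for i j
    proof -
      have "partial_deriv i (\<lambda>y. w i j y * partial_deriv j (F 0) y) x
        = partial_deriv i (\<lambda>y. l * (F 2 y * (w i j y * p j y))) x"
        by (rule arg_cong[where f="\<lambda>f. partial_deriv i f x"]) (simp add: pF mult_ac fun_eq_iff numeral_2_eq_2)
      also have "\<dots> = l * (partial_deriv i (F 2) x * (w i j x * p j x) + F 2 x * partial_deriv i (\<lambda>z. w i j z * p j z) x)"
        by (subst partial_deriv_cmult) (auto intro: differentiable_mult Fd wp simp: partial_deriv_mult Fd wp)
      also have "partial_deriv i (F 2) x = (l * F 4 x - 2 * F 3 x) * p i x"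
        using pF[of i 2 x] by (simp add: numeral_eq_Suc)
      finally show ?thesis
        by (simp only: algebra_simps)
    qed
    then show ?thesis
      by (simp add: P_def Q_def sum.distrib sum_distrib_left)
  qed
  have "coord_laplacian H (F 0) x > 0" if x: "\<delta> \<le> dist x0 x" "dist x0 x < R" for x
  proof -
    have xC: "x \<in> ?C" using x by auto
    then have xS: "x \<in> S" using C by blast
    define t where "t = depth x0 R x"
    have "(dist x0 x)\<^sup>2 < R\<^sup>2"
      using x(2) by (intro power_strict_mono) auto
    then have t: "t > 0" "t \<le> R\<^sup>2"
      by (simp_all add: t_def depth_def dist_norm norm_minus_commute)
    have "(\<Sum>i\<in>UNIV. \<Sum>j\<in>UNIV. partial_deriv i (\<lambda>y. w i j y * partial_deriv j (F 0) y) x)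
        = l * F 2 x * P x + l * (l * F 4 x - 2 * F 3 x) * Q x"
      by (rule formula[OF xS])
    also have "\<dots> = l * F 4 x * (t * t * P x + (l - 2 * t) * Q x)"
    proof -
      have "F 2 x = t * t * F 4 x" "F 3 x = t * F 4 x"
        using t by (simp_all add: F_def t_def[symmetric] flat_def eval_nat_numeral)
      then show ?thesis by (simp add: algebra_simps)
    qed
    also have "\<dots> > 0"
    proof -
      have "t * t * - P x \<le> R\<^sup>2 * R\<^sup>2 * \<bar>P a\<bar>"
      proof -
        have "- P x \<le> \<bar>P a\<bar>" using a(2)[OF xC] by linarith
        then have "t * t * - P x \<le> t * t * \<bar>P a\<bar>"
          using t by (intro mult_left_mono) auto
        also have "\<dots> \<le> R\<^sup>2 * R\<^sup>2 * \<bar>P a\<bar>"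
          using t by (intro mult_right_mono mult_mono) auto
        finally show ?thesis .
      qed
      moreover have "R\<^sup>2 * R\<^sup>2 * \<bar>P a\<bar> + 1 \<le> (l - 2 * t) * Q x"
      proof -
        have "R\<^sup>2 * R\<^sup>2 * \<bar>P a\<bar> + 1 = (l - 2 * R\<^sup>2) * Q b"
          using Qb by (simp add: l_def)
        also have "\<dots> \<le> (l - 2 * t) * Q x"
        proof (rule mult_mono)
          have "0 \<le> (R\<^sup>2 * R\<^sup>2 * \<bar>P a\<bar> + 1) / Q b" using Qb by simp
          then show "l - 2 * R\<^sup>2 \<le> l - 2 * t" "0 \<le> l - 2 * t" using t by (auto simp: l_def)
        qed (use b(2)[OF xC] Qb in auto)
        finally show ?thesis .
      qed
      ultimately have "t * t * P x + (l - 2 * t) * Q x > 0" by simp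
      moreover have "F 4 x > 0" using t by (simp add: F_def flat_def t_def)
      ultimately show ?thesis using l by simp
    qed
    finally have "(\<Sum>i\<in>UNIV. \<Sum>j\<in>UNIV. partial_deriv i (\<lambda>y. w i j y * partial_deriv j (F 0) y) x) > 0" .
    then show ?thesis
      using det_pos[OF xS] by (simp add: coord_laplacian_def w_def)
  qed
  moreover have "coord_laplacian H (F 0) x = 0" if xS: "x \<in> S" and x: "R \<le> dist x0 x" for x
  proof -
    have "R\<^sup>2 \<le> (dist x0 x)\<^sup>2"
      using x \<delta> by (intro power_mono) auto
    then have "F m x = 0" for m
      by (simp add: F_def flat_def depth_def dist_norm norm_minus_commute)
    then show ?thesis
      using formula[OF xS] by (simp add: coord_laplacian_def w_def)
  qed
  ultimately show ?thesis
    using l by (auto simp: F_def[abs_def])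
qed

section \<open>Functions on the manifold\<close>

locale riemannian =
  fixes A :: "('m::{t2_space, second_countable_topology}, 'n::finite) chart set"
    and g :: "'m metric_tensor"
  assumes manifold: "riemannian_manifold A g"
begin

lemma atlas: "smooth_atlas A" and metric: "riemannian_metric A g"
  using manifold by (auto simp: riemannian_manifold_def)

lemma open_chart: "c \<in> A \<Longrightarrow> open (fst c)"
  and open_chart_image: "c \<in> A \<Longrightarrow> open (chart_image c)"
  and chart_homeomorphism: "c \<in> A \<Longrightarrow> homeomorphism (fst c) (chart_image c) (snd c) (chart_inv c)"
  using atlas by (auto simp: smooth_atlas_def)

lemma chart_exists: "\<exists>c\<in>A. p \<in> fst c"
  using atlas unfolding smooth_atlas_def by blast

lemma chart_inv_in: "c \<in> A \<Longrightarrow> x \<in> chart_image c \<Longrightarrow> chart_inv c x \<in> fst c"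
  and snd_chart_inv: "c \<in> A \<Longrightarrow> x \<in> chart_image c \<Longrightarrow> snd c (chart_inv c x) = x"
  and snd_in: "p \<in> fst c \<Longrightarrow> snd c p \<in> chart_image c"
  and chart_inv_snd: "c \<in> A \<Longrightarrow> p \<in> fst c \<Longrightarrow> chart_inv c (snd c p) = p"
  using chart_homeomorphism[of c] by (auto simp: homeomorphism_def chart_image_def)

lemma continuous_chart: "c \<in> A \<Longrightarrow> continuous_on (fst c) (snd c)"
  and continuous_chart_inv: "c \<in> A \<Longrightarrow> continuous_on (chart_image c) (chart_inv c)"
  using chart_homeomorphism[of c] by (auto simp: homeomorphism_def)

lemma chart_restrict_eq:
  "c \<in> A \<Longrightarrow> snd c ` (fst c \<inter> Y) = chart_image c \<inter> chart_inv c -` Y"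
  by (auto simp: snd_in chart_inv_snd image_iff) (metis chart_inv_in snd_chart_inv IntI)

lemma open_chart_restrict: "c \<in> A \<Longrightarrow> open Y \<Longrightarrow> open (snd c ` (fst c \<inter> Y))"
  unfolding chart_restrict_eq
  by (intro continuous_open_preimage continuous_chart_inv open_chart_image)

lemma chart_restrict_iff:
  "c \<in> A \<Longrightarrow> p \<in> fst c \<Longrightarrow> snd c p \<in> snd c ` (fst c \<inter> Y) \<longleftrightarrow> p \<in> Y"
  by (simp add: chart_restrict_eq snd_in chart_inv_snd)

lemma open_chart_preimage: "c \<in> A \<Longrightarrow> open Y \<Longrightarrow> open {p \<in> fst c. snd c p \<in> Y}"
  using continuous_open_preimage[OF continuous_chart open_chart, of c Y]
  by (simp add: vimage_def Int_def)

lemma coord_change_transition: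
  assumes "c \<in> A" "d \<in> A"
  shows "coord_change (snd c ` (fst c \<inter> fst d)) (snd d ` (fst d \<inter> fst c))
    (\<lambda>x. snd d (chart_inv c x)) (\<lambda>y. snd c (chart_inv d y))"
proof
  show "open (snd c ` (fst c \<inter> fst d))" "open (snd d ` (fst d \<inter> fst c))"
    using assms by (auto intro!: open_chart_restrict open_chart)
  show "smooth_on (snd c ` (fst c \<inter> fst d)) (\<lambda>x. snd d (chart_inv c x) $ i)"
    and "smooth_on (snd d ` (fst d \<inter> fst c)) (\<lambda>x. snd c (chart_inv d x) $ i)" for i
    using atlas assms unfolding smooth_atlas_def by blast+
qed (use assms in \<open>auto simp: chart_inv_snd\<close>)

subsection \<open>Smooth functions\<close>

lemma smooth_funD: "smooth_fun A f \<Longrightarrow> c \<in> A \<Longrightarrow> Ck_on k (chart_image c) (f \<circ> chart_inv c)"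
  by (simp add: smooth_fun_def smooth_on_def)

lemma smooth_funI: "(\<And>c k. c \<in> A \<Longrightarrow> Ck_on k (chart_image c) (f \<circ> chart_inv c)) \<Longrightarrow> smooth_fun A f"
  by (simp add: smooth_fun_def smooth_on_def)

lemma smooth_fun_const: "smooth_fun A (\<lambda>_. a)"
  by (rule smooth_funI) (simp add: o_def Ck_on_const open_chart_image)

lemma smooth_fun_add: "smooth_fun A f \<Longrightarrow> smooth_fun A h \<Longrightarrow> smooth_fun A (\<lambda>q. f q + h q)"
  by (rule smooth_funI) (auto simp: o_def intro!: Ck_on_add open_chart_image dest!: smooth_funD)

lemma smooth_fun_mult: "smooth_fun A f \<Longrightarrow> smooth_fun A h \<Longrightarrow> smooth_fun A (\<lambda>q. f q * h q)"
  by (rule smooth_funI) (auto simp: o_def intro!: Ck_on_mult open_chart_image dest!: smooth_funD)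

lemma smooth_fun_differentiable:
  assumes "smooth_fun A f" "c \<in> A" "x \<in> chart_image c"
  shows "(\<lambda>y. f (chart_inv c y)) differentiable (at x)"
  using Ck_on_differentiable[OF smooth_funD[OF assms(1,2)] open_chart_image[OF assms(2)] assms(3)]
  by (simp add: o_def)

lemma continuous_on_manifold:
  fixes f :: "'m \<Rightarrow> real"
  assumes "\<And>c. c \<in> A \<Longrightarrow> continuous_on (chart_image c) (\<lambda>x. f (chart_inv c x))"
  shows "continuous_on UNIV f"
proof -
  have "isCont f p" for p
  proof -
    obtain c where c: "c \<in> A" "p \<in> fst c" using chart_exists by blast
    have "continuous_on (fst c) (\<lambda>q. f (chart_inv c (snd c q)))"
      using continuous_on_compose2[OF assms[OF c(1)] continuous_chart[OF c(1)]] by (simp add: chart_image_def)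
    then have "continuous_on (fst c) f"
      by (simp add: chart_inv_snd c cong: continuous_on_cong)
    then show ?thesis
      using c open_chart continuous_on_eq_continuous_at by blast
  qed
  then show ?thesis by (simp add: continuous_on_eq_continuous_at)
qed

lemma smooth_fun_continuous: "smooth_fun A f \<Longrightarrow> continuous_on UNIV f"
  using Ck_on_continuous[OF smooth_funD[of f _ 0]]
  by (intro continuous_on_manifold) (auto simp: o_def)

definition bump :: "('m, 'n) chart \<Rightarrow> real^'n \<Rightarrow> real \<Rightarrow> real \<Rightarrow> 'm \<Rightarrow> real" where
  "bump c x0 R l p = (if p \<in> fst c then flat l 0 (depth x0 R (snd c p)) else 0)"

lemma bump_nonneg: "bump c x0 R l p \<ge> 0"
  by (simp add: bump_def flat_nonneg)

lemma bump_pos_iff: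
  assumes "R > 0"
  shows "bump c x0 R l p > 0 \<longleftrightarrow> p \<in> fst c \<and> dist x0 (snd c p) < R"
proof -
  have "depth x0 R y > 0 \<longleftrightarrow> dist x0 y < R" for y
    using assms abs_square_less_1 power_mono_iff[of R "dist x0 y" 2]
    by (simp add: depth_def dist_norm norm_minus_commute not_le[symmetric])
  then show ?thesis by (simp add: bump_def flat_def)
qed

lemma bump_eq_0:
  assumes "R > 0" "\<not> (p \<in> fst c \<and> dist x0 (snd c p) < R)"
  shows "bump c x0 R l p = 0"
  using bump_pos_iff[OF assms(1)] assms(2) bump_nonneg[of c x0 R l p] by (metis order_le_less)

lemma bump_chart:
  "c \<in> A \<Longrightarrow> x \<in> chart_image c \<Longrightarrow> bump c x0 R l (chart_inv c x) = flat l 0 (depth x0 R x)"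
  by (simp add: bump_def chart_inv_in snd_chart_inv)

lemma bump_support:
  assumes "c \<in> A" "cball x0 R \<subseteq> chart_image c" "R > 0"
  shows "closed (chart_inv c ` cball x0 R)"
    and "q \<notin> chart_inv c ` cball x0 R \<Longrightarrow> bump c x0 R l q = 0"
    and "chart_inv c ` cball x0 R \<subseteq> fst c"
proof -
  show "closed (chart_inv c ` cball x0 R)"
    using continuous_on_subset[OF continuous_chart_inv[OF assms(1)] assms(2)]
    by (intro compact_imp_closed compact_continuous_image) auto
  show "chart_inv c ` cball x0 R \<subseteq> fst c"
    using assms chart_inv_in by blast
  show "bump c x0 R l q = 0" if "q \<notin> chart_inv c ` cball x0 R"
  proof (rule bump_eq_0[OF assms(3)], rule notI)
    assume "q \<in> fst c \<and> dist x0 (snd c q) < R"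
    then have "q = chart_inv c (snd c q)" "snd c q \<in> cball x0 R"
      using chart_inv_snd assms(1) by auto
    then show False using that by blast
  qed
qed

text \<open>
  Near points of the chart the bump is a smooth function of the coordinates. All other points have a
  neighbourhood on which it vanishes, because its support is the image of a compact ball and hence
  closed in the Hausdorff space.
\<close>

lemma smooth_fun_bump:
  assumes c: "c \<in> A" and sub: "cball x0 R \<subseteq> chart_image c" and R: "R > 0" and l: "l > 0"
  shows "smooth_fun A (bump c x0 R l)"
proof (rule smooth_funI)
  fix d k assume d: "d \<in> A"
  note supp = bump_support[OF c sub R]
  show "Ck_on k (chart_image d) (bump c x0 R l \<circ> chart_inv d)"
  proof (rule Ck_on_local[OF _ open_chart_image[OF d]])
    fix y assume y: "y \<in> chart_image d"
    show "\<exists>U. open U \<and> y \<in> U \<and> U \<subseteq> chart_image d \<and> Ck_on k U (bump c x0 R l \<circ> chart_inv d)"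
    proof (cases "chart_inv d y \<in> fst c")
      case True
      interpret coord_change "snd d ` (fst d \<inter> fst c)" "snd c ` (fst c \<inter> fst d)"
        "\<lambda>x. snd c (chart_inv d x)" "\<lambda>y. snd d (chart_inv c y)"
        by (rule coord_change_transition[OF d c])
      have "Ck_on k (snd d ` (fst d \<inter> fst c)) (\<lambda>z. flat l 0 (depth x0 R (snd c (chart_inv d z))))"
        by (rule Ck_on_compose[OF open_U open_V, where f = "\<lambda>y. flat l 0 (depth x0 R y)"])
           (auto intro!: \<phi>_in Ck_on_flat_depth[OF open_V l] smooth_onD smooth_\<phi>)
      then have "Ck_on k (snd d ` (fst d \<inter> fst c)) (bump c x0 R l \<circ> chart_inv d)"
        by (rule Ck_on_cong[OF open_U, rotated]) (auto simp: chart_inv_snd d bump_def)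
      moreover have "y \<in> snd d ` (fst d \<inter> fst c)"
        using True y d by (simp add: chart_restrict_eq)
      ultimately show ?thesis
        using open_U by (intro exI[of _ "snd d ` (fst d \<inter> fst c)"]) (auto simp: snd_in)
    next
      case False
      let ?U = "snd d ` (fst d \<inter> - (chart_inv c ` cball x0 R))"
      have U: "open ?U" using supp(1) by (intro open_chart_restrict d) auto
      have "Ck_on k ?U (bump c x0 R l \<circ> chart_inv d)"
      proof (rule Ck_on_cong[OF U _ Ck_on_const[OF U]])
        show "0 = (bump c x0 R l \<circ> chart_inv d) z" if "z \<in> ?U" for z
          using that supp(2) d by (auto simp: chart_restrict_eq)
      qed
      moreover have "y \<in> ?U"
        using False supp(3) y d by (auto simp: chart_restrict_eq)
      ultimately show ?thesis
        using U by (intro exI[of _ ?U]) (auto simp: snd_in)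
    qed
  qed
qed

subsection \<open>Coordinate vectors and the metric matrix\<close>

lemma coord_vector_tangent:
  assumes c: "c \<in> A" and p: "p \<in> fst c"
  shows "coord_vector A c i p \<in> tangent_space A p"
  unfolding tangent_space_def
proof (intro CollectI conjI allI impI)
  fix f h :: "'m \<Rightarrow> real" and a b :: real
  assume f: "smooth_fun A f" and h: "smooth_fun A h"
  note d = smooth_fun_differentiable[OF f c snd_in[OF p]] smooth_fun_differentiable[OF h c snd_in[OF p]]
  have "smooth_fun A (\<lambda>q. a * f q + b * h q)"
    by (intro smooth_fun_add smooth_fun_mult smooth_fun_const f h)
  then show "coord_vector A c i p (\<lambda>q. a * f q + b * h q) = a * coord_vector A c i p f + b * coord_vector A c i p h"
    using d by (simp add: coord_vector_def f h o_def partial_deriv_add partial_deriv_cmult)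
  have "smooth_fun A (\<lambda>q. f q * h q)"
    by (intro smooth_fun_mult f h)
  then show "coord_vector A c i p (\<lambda>q. f q * h q) = coord_vector A c i p f * h p + f p * coord_vector A c i p h"
    using d by (simp add: coord_vector_def f h o_def partial_deriv_mult chart_inv_snd c p)
qed (simp add: coord_vector_def)

lemma tangent_lincomb:
  assumes "X \<in> tangent_space A p" "Y \<in> tangent_space A p"
  shows "(\<lambda>f. a * X f + b * Y f) \<in> tangent_space A p"
  using assms unfolding tangent_space_def by (simp add: algebra_simps)

lemma tangent_zero: "(\<lambda>_. 0) \<in> tangent_space A p"
  by (simp add: tangent_space_def)

lemma metric_lincomb:
  "X \<in> tangent_space A p \<Longrightarrow> Y \<in> tangent_space A p \<Longrightarrow> Z \<in> tangent_space A p \<Longrightarrow>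
    g p (\<lambda>f. a * X f + b * Y f) Z = a * g p X Z + b * g p Y Z"
  using metric unfolding riemannian_metric_def by blast

lemma metric_sym:
  "X \<in> tangent_space A p \<Longrightarrow> Y \<in> tangent_space A p \<Longrightarrow> g p X Y = g p Y X"
  using metric unfolding riemannian_metric_def by blast

lemma metric_sum_left:
  assumes "finite I" "\<And>i. i \<in> I \<Longrightarrow> X i \<in> tangent_space A p" "Z \<in> tangent_space A p"
  shows "(\<lambda>f. \<Sum>i\<in>I. a i * X i f) \<in> tangent_space A p \<and>
    g p (\<lambda>f. \<Sum>i\<in>I. a i * X i f) Z = (\<Sum>i\<in>I. a i * g p (X i) Z)"
  using assms(1,2)
proof (induction I)
  case empty
  then show ?case
    using metric_lincomb[OF tangent_zero tangent_zero assms(3), of 0 0] tangent_zero by simp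
next
  case (insert j I)
  then have X: "X j \<in> tangent_space A p" and I: "(\<lambda>f. \<Sum>i\<in>I. a i * X i f) \<in> tangent_space A p"
    "g p (\<lambda>f. \<Sum>i\<in>I. a i * X i f) Z = (\<Sum>i\<in>I. a i * g p (X i) Z)" by auto
  show ?case
    using tangent_lincomb[OF X I(1), of "a j" 1] metric_lincomb[OF X I(1) assms(3), of "a j" 1] I(2) insert.hyps
    by simp
qed

lemma metric_sum_sum:
  fixes X Y :: "'n \<Rightarrow> 'm tangent_vector"
  assumes X: "\<And>i. X i \<in> tangent_space A p" and Y: "\<And>i. Y i \<in> tangent_space A p"
  shows "g p (\<lambda>f. \<Sum>i\<in>UNIV. a i * X i f) (\<lambda>f. \<Sum>j\<in>UNIV. b j * Y j f)
    = (\<Sum>i\<in>UNIV. \<Sum>j\<in>UNIV. a i * b j * g p (X i) (Y j))"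
proof -
  let ?Z = "\<lambda>f. \<Sum>j\<in>UNIV. b j * Y j f"
  have Z: "?Z \<in> tangent_space A p"
    using metric_sum_left[of UNIV Y p "X undefined" b] X Y by simp
  have "g p (X i) ?Z = (\<Sum>j\<in>UNIV. b j * g p (X i) (Y j))" for i
    using metric_sum_left[of UNIV Y p "X i" b] metric_sym[OF X Z] metric_sym[OF X Y] X Y by simp
  then show ?thesis
    using metric_sum_left[of UNIV X p ?Z a] X Z by (simp add: sum_distrib_left mult_ac)
qed

text \<open>
  The test function is a bump centred at \<open>x + e v\<close>: moving from \<open>x\<close> in the direction \<open>v\<close>, one
  approaches the centre, and the bump increases to first order.
\<close>

lemma coord_vectors_independent:
  assumes c: "c \<in> A" and x: "x \<in> chart_image c" and v: "v \<noteq> 0"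
  shows "(\<lambda>f. \<Sum>i\<in>UNIV. v $ i * coord_vector A c i (chart_inv c x) f) \<noteq> (\<lambda>_. 0)"
proof -
  obtain r where r: "r > 0" "cball x r \<subseteq> chart_image c"
    using open_chart_image[OF c] x open_contains_cball by blast
  define e where "e = r / (4 * norm v)"
  have e: "e > 0" "e * norm v = r / 4" using r v by (simp_all add: e_def)
  define x0 where "x0 = x + e *\<^sub>R v"
  have dist: "dist x0 x = r / 4" using e by (simp add: x0_def dist_norm)
  have sub: "cball x0 (r / 2) \<subseteq> chart_image c"
  proof (rule order_trans[OF subsetI r(2)])
    fix y assume "y \<in> cball x0 (r / 2)"
    then show "y \<in> cball x r"
      using dist_triangle[of x y x0] dist r(1) by (simp add: dist_commute)
  qed
  let ?b = "bump c x0 (r / 2) 1"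
  have sm: "smooth_fun A ?b"
    by (rule smooth_fun_bump[OF c sub]) (use r in auto)
  define s where "s = flat 1 2 (depth x0 (r / 2) x)"
  have "depth x0 (r / 2) x = (r / 2)\<^sup>2 - (r / 4)\<^sup>2"
  proof -
    have "norm (x - x0) = r / 4" using dist by (simp add: dist_norm norm_minus_commute)
    then show ?thesis by (simp only: depth_def)
  qed
  then have "depth x0 (r / 2) x > 0"
    using mult_pos_pos[OF r(1) r(1)] by (simp add: power2_eq_square field_simps)
  then have s: "s > 0" by (simp add: s_def flat_def)
  have "coord_vector A c i (chart_inv c x) ?b = 2 * s * e * v $ i" for i
  proof -
    have "partial_deriv i (?b \<circ> chart_inv c) x = partial_deriv i (\<lambda>y. flat 1 0 (depth x0 (r / 2) y)) x"
      by (rule partial_deriv_cong[OF open_chart_image[OF c] x]) (simp add: bump_chart c)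
    then show ?thesis
      using sm by (simp add: coord_vector_def snd_chart_inv c x partial_deriv_flat_depth s_def x0_def numeral_2_eq_2)
  qed
  then have "(\<Sum>i\<in>UNIV. v $ i * coord_vector A c i (chart_inv c x) ?b) = 2 * s * e * (v \<bullet> v)"
    by (simp add: inner_vec_def sum_distrib_left mult_ac)
  also have "\<dots> > 0" using s e v by simp
  finally show ?thesis by (metis less_irrefl)
qed

lemma posdef_metric_matrix:
  assumes c: "c \<in> A" and x: "x \<in> chart_image c"
  shows "posdef (metric_matrix A g c x)"
  unfolding posdef_def
proof (intro allI impI)
  fix v :: "real^'n" assume v: "v \<noteq> 0"
  let ?p = "chart_inv c x"
  let ?X = "\<lambda>i. coord_vector A c i ?p"
  have T: "?X i \<in> tangent_space A ?p" for i
    by (intro coord_vector_tangent c chart_inv_in x)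
  have "0 < g ?p (\<lambda>f. \<Sum>i\<in>UNIV. v $ i * ?X i f) (\<lambda>f. \<Sum>i\<in>UNIV. v $ i * ?X i f)"
    using metric coord_vectors_independent[OF c x v] metric_sum_left[of UNIV ?X ?p "?X undefined" "($) v"] T
    unfolding riemannian_metric_def by simp
  also have "\<dots> = v \<bullet> (metric_matrix A g c x *v v)"
    by (simp add: metric_sum_sum T inner_matrix_sum metric_matrix_def Let_def mult_ac)
  finally show "0 < v \<bullet> (metric_matrix A g c x *v v)" .
qed

lemma coord_metric_chart:
  assumes c: "c \<in> A" and S: "open S" "S \<subseteq> chart_image c"
  shows "coord_metric S (metric_matrix A g c)"
proof
  show "smooth_on S (\<lambda>x. metric_matrix A g c x $ i $ j)" for i j
    using metric c S(2) unfolding riemannian_metric_def smooth_on_def by (meson Ck_on_subset)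
  show "det (metric_matrix A g c x) > 0" if "x \<in> S" for x
    using posdef_det_pos[OF posdef_metric_matrix[OF c]] that S by blast
qed (rule S)

lemma metric_matrix_change:
  assumes c: "c \<in> A" and d: "d \<in> A" and x: "x \<in> snd c ` (fst c \<inter> fst d)"
  defines "\<phi> \<equiv> \<lambda>x. snd d (chart_inv c x)"
  shows "metric_matrix A g c x = transpose (coord_change.J \<phi> x) ** metric_matrix A g d (\<phi> x) ** coord_change.J \<phi> x"
proof -
  interpret coord_change "snd c ` (fst c \<inter> fst d)" "snd d ` (fst d \<inter> fst c)" \<phi> "\<lambda>y. snd c (chart_inv d y)"
    unfolding \<phi>_def by (rule coord_change_transition[OF c d])
  let ?p = "chart_inv c x"
  have xc: "x \<in> chart_image c" and p: "?p \<in> fst c" "?p \<in> fst d"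
    using x c by (auto simp: snd_in chart_inv_snd)
  have inv: "chart_inv d (\<phi> x) = ?p" by (simp add: \<phi>_def chart_inv_snd d p)
  have vec: "coord_vector A c i ?p = (\<lambda>f. \<Sum>a\<in>UNIV. J x $ a $ i * coord_vector A d a ?p f)" for i
  proof
    fix f
    show "coord_vector A c i ?p f = (\<Sum>a\<in>UNIV. J x $ a $ i * coord_vector A d a ?p f)"
    proof (cases "smooth_fun A f")
      case True
      have "partial_deriv i (f \<circ> chart_inv c) x = partial_deriv i (\<lambda>y. f (chart_inv d (\<phi> y))) x"
        by (rule partial_deriv_cong[OF open_U x]) (auto simp: \<phi>_def chart_inv_snd c d)
      also have "\<dots> = (\<Sum>a\<in>UNIV. J x $ a $ i * partial_deriv a (\<lambda>y. f (chart_inv d y)) (\<phi> x))"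
        unfolding J_def vec_lambda_beta
        by (rule partial_deriv_chain[OF smooth_fun_differentiable[OF True d] d_\<phi>[OF x]])
           (simp add: \<phi>_def snd_in p)
      finally show ?thesis
        using True by (simp add: coord_vector_def snd_chart_inv c xc \<phi>_def o_def)
    qed (simp add: coord_vector_def)
  qed
  have T: "coord_vector A d a ?p \<in> tangent_space A ?p" for a
    by (intro coord_vector_tangent d p)
  have "metric_matrix A g c x $ i $ j = (transpose (J x) ** metric_matrix A g d (\<phi> x) ** J x) $ i $ j" for i j
  proof -
    have "metric_matrix A g c x $ i $ j = g ?p (coord_vector A c i ?p) (coord_vector A c j ?p)"
      by (simp add: metric_matrix_def Let_def)
    also have "\<dots> = (\<Sum>a\<in>UNIV. \<Sum>b\<in>UNIV. J x $ a $ i * J x $ b $ j * g ?p (coord_vector A d a ?p) (coord_vector A d b ?p))"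
      unfolding vec by (rule metric_sum_sum[OF T T])
    also have "\<dots> = (\<Sum>b\<in>UNIV. \<Sum>a\<in>UNIV. J x $ a $ i * J x $ b $ j * g ?p (coord_vector A d a ?p) (coord_vector A d b ?p))"
      by (rule sum.swap)
    also have "\<dots> = (transpose (J x) ** metric_matrix A g d (\<phi> x) ** J x) $ i $ j"
      by (simp add: matrix_matrix_mult_def transpose_def metric_matrix_def Let_def inv sum_distrib_right sum_distrib_left mult_ac)
    finally show ?thesis .
  qed
  then show ?thesis by (simp add: vec_eq_iff)
qed

subsection \<open>The Laplace operator on the manifold\<close>

lemma laplacian_change:
  assumes c: "c \<in> A" "p \<in> fst c" and d: "d \<in> A" "p \<in> fst d" and f: "smooth_fun A f"
  shows "laplacian A g c f p = laplacian A g d f p"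
proof -
  define \<phi> where "\<phi> = (\<lambda>x. snd d (chart_inv c x))"
  interpret coord_change "snd c ` (fst c \<inter> fst d)" "snd d ` (fst d \<inter> fst c)" \<phi> "\<lambda>y. snd c (chart_inv d y)"
    unfolding \<phi>_def by (rule coord_change_transition[OF c(1) d(1)])
  have x: "snd c p \<in> snd c ` (fst c \<inter> fst d)" using c d by blast
  have sub: "snd d ` (fst d \<inter> fst c) \<subseteq> chart_image d" by (auto simp: snd_in)
  have "coord_laplacian (metric_matrix A g c) (f \<circ> chart_inv c) (snd c p)
      = coord_laplacian (metric_matrix A g c) (\<lambda>y. (f \<circ> chart_inv d) (\<phi> y)) (snd c p)"
    by (rule coord_laplacian_cong[OF open_U x]) (auto simp: \<phi>_def chart_inv_snd c d)
  also have "\<dots> = coord_laplacian (metric_matrix A g d) (f \<circ> chart_inv d) (\<phi> (snd c p))"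
    by (rule coord_laplacian_change[OF x coord_metric_chart[OF d(1) open_V sub]
          Ck_on_subset[OF smooth_funD[OF f d(1)] sub]])
       (simp add: metric_matrix_change[OF c(1) d(1)] \<phi>_def)
  finally show ?thesis
    by (simp add: laplacian_coord \<phi>_def chart_inv_snd c)
qed

text \<open>
  By \<open>laplacian_change\<close> the choice of the chart does not matter for smooth functions.
\<close>

definition lap :: "('m \<Rightarrow> real) \<Rightarrow> 'm \<Rightarrow> real" where
  "lap f p = laplacian A g (SOME c. c \<in> A \<and> p \<in> fst c) f p"

lemma lap_eq:
  assumes "c \<in> A" "p \<in> fst c" "smooth_fun A f"
  shows "laplacian A g c f p = lap f p"
  unfolding lap_def
proof (rule laplacian_change[OF assms(1,2) _ _ assms(3)])
  have "(SOME c. c \<in> A \<and> p \<in> fst c) \<in> A \<and> p \<in> fst (SOME c. c \<in> A \<and> p \<in> fst c)"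
    by (rule someI[of _ c]) (use assms in simp)
  then show "(SOME c. c \<in> A \<and> p \<in> fst c) \<in> A" "p \<in> fst (SOME c. c \<in> A \<and> p \<in> fst c)" by auto
qed

lemma lap_coord:
  assumes "c \<in> A" "p \<in> fst c" "smooth_fun A f"
  shows "lap f p = coord_laplacian (metric_matrix A g c) (f \<circ> chart_inv c) (snd c p)"
  using lap_eq[OF assms] by (simp add: laplacian_coord)

lemma continuous_lap:
  assumes f: "smooth_fun A f"
  shows "continuous_on UNIV (lap f)"
proof (rule continuous_on_manifold)
  fix c assume c: "c \<in> A"
  interpret coord_metric "chart_image c" "metric_matrix A g c"
    by (rule coord_metric_chart[OF c open_chart_image[OF c] order_refl])
  have "continuous_on (chart_image c) (coord_laplacian (metric_matrix A g c) (f \<circ> chart_inv c))"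
    by (rule continuous_coord_laplacian[OF smooth_funD[OF f c]])
  then show "continuous_on (chart_image c) (\<lambda>x. lap f (chart_inv c x))"
    by (simp add: lap_coord[OF c _ f] chart_inv_in snd_chart_inv c cong: continuous_on_cong)
qed

lemma lap_add_cmult:
  assumes f: "smooth_fun A f" and h: "smooth_fun A h"
  shows "lap (\<lambda>q. f q + a * h q) p = lap f p + a * lap h p"
proof -
  obtain c where c: "c \<in> A" "p \<in> fst c" using chart_exists by blast
  interpret coord_metric "chart_image c" "metric_matrix A g c"
    by (rule coord_metric_chart[OF c(1) open_chart_image[OF c(1)] order_refl])
  have "smooth_fun A (\<lambda>q. f q + a * h q)"
    by (intro smooth_fun_add smooth_fun_mult smooth_fun_const f h)
  then show ?thesis
    using coord_laplacian_add_cmult[OF smooth_funD[OF f c(1)] smooth_funD[OF h c(1)] snd_in[OF c(2)], of a]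
    by (simp add: lap_coord[OF c] f h o_def)
qed

lemma lap_zero: "lap (\<lambda>_. 0) p = 0"
  using lap_add_cmult[OF smooth_fun_const smooth_fun_const, of 0 "-1" 0 p] by simp

lemma lap_local:
  assumes f: "smooth_fun A f" and h: "smooth_fun A h"
    and O: "open Y" "p \<in> Y" "\<And>q. q \<in> Y \<Longrightarrow> f q = h q"
  shows "lap f p = lap h p"
proof -
  obtain c where c: "c \<in> A" "p \<in> fst c" using chart_exists by blast
  have "snd c p \<in> snd c ` (fst c \<inter> Y)" using c O by blast
  then show ?thesis
    unfolding lap_coord[OF c f] lap_coord[OF c h]
    by (rule coord_laplacian_cong[OF open_chart_restrict[OF c(1) O(1)]])
       (auto simp: chart_inv_snd c O)
qed

lemma barrier_exists:
  assumes c: "c \<in> A" and sub: "cball x0 R \<subseteq> chart_image c" and \<delta>: "0 < \<delta>" "\<delta> < R"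
  obtains \<beta> where "smooth_fun A \<beta>" "\<And>p. \<beta> p \<ge> 0"
    "\<And>p. \<beta> p > 0 \<longleftrightarrow> p \<in> fst c \<and> dist x0 (snd c p) < R"
    "\<And>p. p \<in> fst c \<Longrightarrow> \<delta> \<le> dist x0 (snd c p) \<Longrightarrow> dist x0 (snd c p) < R \<Longrightarrow> lap \<beta> p > 0"
    "\<And>p. lap \<beta> p < 0 \<Longrightarrow> p \<in> fst c \<and> dist x0 (snd c p) < \<delta>"
proof -
  interpret coord_metric "chart_image c" "metric_matrix A g c"
    by (rule coord_metric_chart[OF c open_chart_image[OF c] order_refl])
  have R: "R > 0" using \<delta> by simp
  let ?L = "\<lambda>l x. coord_laplacian (metric_matrix A g c) (\<lambda>y. flat l 0 (depth x0 R y)) x"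
  obtain l where l: "l > 0" and pos: "\<And>x. \<delta> \<le> dist x0 x \<Longrightarrow> dist x0 x < R \<Longrightarrow> ?L l x > 0"
    and zero: "\<And>x. x \<in> chart_image c \<Longrightarrow> R \<le> dist x0 x \<Longrightarrow> ?L l x = 0"
    using barrier[OF posdef_metric_matrix[OF c] sub \<delta>] by blast
  let ?b = "bump c x0 R l"
  have sm: "smooth_fun A ?b" by (rule smooth_fun_bump[OF c sub R l])
  have lap: "lap ?b p = ?L l (snd c p)" if "p \<in> fst c" for p
    unfolding lap_coord[OF c that sm]
    by (rule coord_laplacian_cong[OF open_chart_image[OF c] snd_in[OF that]]) (simp_all add: bump_chart c)
  have outside: "lap ?b p = 0" if "p \<notin> fst c" for p
  proof -
    note supp = bump_support[OF c sub R]
    have "lap ?b p = lap (\<lambda>_. 0) p"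
      by (rule lap_local[OF sm smooth_fun_const, where Y = "- chart_inv c ` cball x0 R"])
         (use supp that in auto)
    then show ?thesis by (simp add: lap_zero)
  qed
  have neg: "p \<in> fst c \<and> dist x0 (snd c p) < \<delta>" if "lap ?b p < 0" for p
  proof -
    have p: "p \<in> fst c" using that outside by force
    then show ?thesis
      using that lap[OF p] pos[of "snd c p"] zero[OF snd_in[OF p]] by linarith
  qed
  show ?thesis
  proof (rule that[of ?b])
    show "lap ?b p > 0" if "p \<in> fst c" "\<delta> \<le> dist x0 (snd c p)" "dist x0 (snd c p) < R" for p
      using lap pos that by simp
  qed (fact sm bump_nonneg bump_pos_iff[OF R] neg)+
qed

subsection \<open>Functions that are subharmonic off a given set\<close>

definition subharmonic_off :: "'m set \<Rightarrow> 'm set \<Rightarrow> ('m \<Rightarrow> real) \<Rightarrow> bool" where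
  "subharmonic_off W B \<alpha> \<longleftrightarrow> smooth_fun A \<alpha> \<and> (\<forall>p. \<alpha> p \<ge> 0) \<and> (\<forall>p. p \<notin> B \<longrightarrow> \<alpha> p = 0) \<and>
    (\<forall>p. p \<notin> W \<longrightarrow> lap \<alpha> p \<ge> 0)"

text \<open>
  Points of \<open>W\<close> count unconditionally: no condition on the Laplacian is imposed there, so they are
  where the propagation starts.
\<close>

definition strict_at :: "'m set \<Rightarrow> 'm set \<Rightarrow> 'm \<Rightarrow> bool" where
  "strict_at W B q \<longleftrightarrow> q \<in> W \<or> (\<exists>\<alpha>. subharmonic_off W B \<alpha> \<and> \<alpha> q > 0 \<and> lap \<alpha> q > 0)"

lemma subharmonic_off_sum:
  assumes "finite F" "\<And>i. i \<in> F \<Longrightarrow> subharmonic_off W B (\<alpha> i)"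
  shows "subharmonic_off W B (\<lambda>q. \<Sum>i\<in>F. \<alpha> i q) \<and>
    (\<forall>p. lap (\<lambda>q. \<Sum>i\<in>F. \<alpha> i q) p = (\<Sum>i\<in>F. lap (\<alpha> i) p))"
  using assms
proof (induction F)
  case empty
  then show ?case by (simp add: subharmonic_off_def smooth_fun_const lap_zero)
next
  case (insert j F)
  then have j: "subharmonic_off W B (\<alpha> j)" and F: "subharmonic_off W B (\<lambda>q. \<Sum>i\<in>F. \<alpha> i q)"
    "\<And>p. lap (\<lambda>q. \<Sum>i\<in>F. \<alpha> i q) p = (\<Sum>i\<in>F. lap (\<alpha> i) p)"
    by auto
  have "lap (\<lambda>q. \<alpha> j q + (\<Sum>i\<in>F. \<alpha> i q)) p = lap (\<alpha> j) p + (\<Sum>i\<in>F. lap (\<alpha> i) p)" for p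
    using lap_add_cmult[of "\<alpha> j" "\<lambda>q. \<Sum>i\<in>F. \<alpha> i q" 1 p] j F by (simp add: subharmonic_off_def)
  then show ?case
    using insert.hyps j F by (simp add: subharmonic_off_def smooth_fun_add)
qed

text \<open>
  A barrier centred at \<open>t\<close> is strictly subharmonic at \<open>q\<close> and fails to be subharmonic only on a ball
  about \<open>t\<close> of a radius that can be prescribed. If \<open>t\<close> lies in \<open>W\<close>, that ball fits into \<open>W\<close>; otherwise it fits into
  the set where the function \<open>\<alpha>\<close> given for \<open>t\<close> is strictly subharmonic, and a large multiple of \<open>\<alpha>\<close>
  outweighs the negative Laplacian there.
\<close>

lemma strict_at_push:
  assumes W: "open W" and c: "c \<in> A" and t: "t \<in> fst c" "strict_at W B t"
    and sub: "cball (snd c t) R \<subseteq> snd c ` (fst c \<inter> B)"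
    and q: "q \<in> fst c" "dist (snd c t) (snd c q) < R"
  shows "strict_at W B q"
proof (cases "q \<in> W \<or> q = t")
  case True
  then show ?thesis using t by (auto simp: strict_at_def)
next
  case False
  let ?x = "snd c t"
  have d: "dist ?x (snd c q) > 0"
    using False c t q by (metis chart_inv_snd zero_less_dist_iff)
  have Bc: "p \<in> B" if "p \<in> fst c" "dist ?x (snd c p) < R" for p
    using sub that chart_restrict_iff[OF c that(1), of B] by (auto simp: subset_iff)
  have sub': "cball ?x R \<subseteq> chart_image c"
    using sub by (auto simp: chart_image_def)
  have shrink: "\<exists>\<delta>>0. \<delta> \<le> dist ?x (snd c q) \<and> cball ?x \<delta> \<subseteq> snd c ` (fst c \<inter> N)" if N: "open N" "t \<in> N" for N
  proof -
    obtain e where e: "e > 0" "cball ?x e \<subseteq> snd c ` (fst c \<inter> N)"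
      using open_chart_restrict[OF c N(1)] t N(2) open_contains_cball by (metis IntI imageI)
    then show ?thesis
      using d by (intro exI[of _ "min e (dist ?x (snd c q))"]) auto
  qed
  have "\<exists>\<alpha>. subharmonic_off W B \<alpha> \<and> \<alpha> q > 0 \<and> lap \<alpha> q > 0"
  proof (cases "t \<in> W")
    case True
    obtain \<delta> where \<delta>: "\<delta> > 0" "\<delta> \<le> dist ?x (snd c q)" "cball ?x \<delta> \<subseteq> snd c ` (fst c \<inter> W)"
      using shrink[OF W True] by blast
    obtain \<beta> where \<beta>: "smooth_fun A \<beta>" "\<And>p. \<beta> p \<ge> 0"
        "\<And>p. \<beta> p > 0 \<longleftrightarrow> p \<in> fst c \<and> dist ?x (snd c p) < R"
        "\<And>p. p \<in> fst c \<Longrightarrow> \<delta> \<le> dist ?x (snd c p) \<Longrightarrow> dist ?x (snd c p) < R \<Longrightarrow> lap \<beta> p > 0"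
        "\<And>p. lap \<beta> p < 0 \<Longrightarrow> p \<in> fst c \<and> dist ?x (snd c p) < \<delta>"
      by (rule barrier_exists[OF c sub' \<delta>(1) order_le_less_trans[OF \<delta>(2) q(2)]]) (rule that; assumption)
    have "lap \<beta> p \<ge> 0" if "p \<notin> W" for p
    proof (rule ccontr)
      assume "\<not> lap \<beta> p \<ge> 0"
      then have p: "p \<in> fst c" "snd c p \<in> cball ?x \<delta>" using \<beta>(5)[of p] by auto
      then show False using \<delta>(3) that chart_restrict_iff[OF c p(1), of W] by blast
    qed
    moreover have "\<beta> p = 0" if "p \<notin> B" for p
      using \<beta>(2)[of p] \<beta>(3)[of p] Bc[of p] that by (metis order_le_less)
    ultimately have "subharmonic_off W B \<beta>"
      using \<beta>(1,2) by (simp add: subharmonic_off_def)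
    then show ?thesis using \<beta>(3,4) q \<delta>(2) by blast
  next
    case False
    then obtain \<alpha> where \<alpha>: "subharmonic_off W B \<alpha>" "lap \<alpha> t > 0"
      using t(2) by (auto simp: strict_at_def)
    then have sm: "smooth_fun A \<alpha>" by (simp add: subharmonic_off_def)
    have "open {p. 0 < lap \<alpha> p}"
      by (intro open_Collect_less continuous_lap sm continuous_on_const)
    then obtain \<delta> where \<delta>: "\<delta> > 0" "\<delta> \<le> dist ?x (snd c q)"
        "cball ?x \<delta> \<subseteq> snd c ` (fst c \<inter> {p. 0 < lap \<alpha> p})"
      using shrink[of "{p. 0 < lap \<alpha> p}"] \<alpha>(2) by blast
    obtain \<beta> where \<beta>: "smooth_fun A \<beta>" "\<And>p. \<beta> p \<ge> 0"
        "\<And>p. \<beta> p > 0 \<longleftrightarrow> p \<in> fst c \<and> dist ?x (snd c p) < R"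
        "\<And>p. p \<in> fst c \<Longrightarrow> \<delta> \<le> dist ?x (snd c p) \<Longrightarrow> dist ?x (snd c p) < R \<Longrightarrow> lap \<beta> p > 0"
        "\<And>p. lap \<beta> p < 0 \<Longrightarrow> p \<in> fst c \<and> dist ?x (snd c p) < \<delta>"
      by (rule barrier_exists[OF c sub' \<delta>(1) order_le_less_trans[OF \<delta>(2) q(2)]]) (rule that; assumption)
    let ?D = "chart_inv c ` cball ?x \<delta>"
    have "cball ?x \<delta> \<subseteq> chart_image c" using \<delta>(3) by (auto simp: chart_image_def)
    then have D: "compact ?D"
      using continuous_chart_inv[OF c] continuous_on_subset
      by (intro compact_continuous_image) auto
    have D0: "?D \<noteq> {}" using \<delta>(1) by simp
    have pos: "lap \<alpha> p > 0" if "p \<in> ?D" for p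
      using that \<delta>(3) c by (auto simp: chart_inv_snd subset_iff)
    obtain a where a: "a \<in> ?D" "\<And>p. p \<in> ?D \<Longrightarrow> lap \<alpha> a \<le> lap \<alpha> p"
      using continuous_attains_inf[OF D D0 continuous_on_subset[OF continuous_lap[OF sm]]] by blast
    obtain b where b: "b \<in> ?D" "\<And>p. p \<in> ?D \<Longrightarrow> lap \<beta> b \<le> lap \<beta> p"
      using continuous_attains_inf[OF D D0 continuous_on_subset[OF continuous_lap[OF \<beta>(1)]]] by blast
    \<comment> \<open>the ratio of the worst values of the two Laplacians on the bad ball\<close>
    define C where "C = \<bar>lap \<beta> b\<bar> / lap \<alpha> a"
    have C: "C \<ge> 0" using pos[OF a(1)] by (simp add: C_def)
    let ?\<gamma> = "\<lambda>p. \<beta> p + C * \<alpha> p"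
    have lap: "lap ?\<gamma> p = lap \<beta> p + C * lap \<alpha> p" for p
      by (rule lap_add_cmult[OF \<beta>(1) sm])
    have "lap ?\<gamma> p \<ge> 0" if "p \<notin> W" for p
    proof (cases "lap \<beta> p < 0")
      case True
      then have "p \<in> fst c" "snd c p \<in> cball ?x \<delta>" using \<beta>(5)[of p] by auto
      then have p: "p \<in> ?D" using chart_inv_snd[OF c] by (metis imageI)
      have "\<bar>lap \<beta> b\<bar> = C * lap \<alpha> a" using pos[OF a(1)] by (simp add: C_def)
      also have "\<dots> \<le> C * lap \<alpha> p" using a(2)[OF p] C by (rule mult_left_mono)
      finally show ?thesis using b(2)[OF p] lap[of p] by linarith
    next
      case False
      then show ?thesis using that C \<alpha>(1) by (simp add: lap subharmonic_off_def)
    qed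
    moreover have "?\<gamma> p = 0" if "p \<notin> B" for p
      using \<beta>(2)[of p] \<beta>(3)[of p] Bc[of p] that \<alpha>(1) by (auto simp: subharmonic_off_def)
    moreover have "?\<gamma> p \<ge> 0" for p
      using \<beta>(2)[of p] \<alpha>(1) C by (simp add: subharmonic_off_def)
    moreover have "smooth_fun A ?\<gamma>"
      by (intro smooth_fun_add smooth_fun_mult smooth_fun_const \<beta>(1) sm)
    ultimately have "subharmonic_off W B ?\<gamma>" by (simp add: subharmonic_off_def)
    moreover have "?\<gamma> q > 0"
      using \<beta>(3)[of q] q \<alpha>(1) C by (simp add: subharmonic_off_def add_pos_nonneg)
    moreover have "lap ?\<gamma> q > 0"
      using \<beta>(4)[of q] q \<delta>(2) \<alpha>(1) C \<open>\<not> (q \<in> W \<or> q = t)\<close>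
      by (simp add: lap subharmonic_off_def add_pos_nonneg)
    ultimately show ?thesis by blast
  qed
  then show ?thesis by (simp add: strict_at_def)
qed

text \<open>
  Two points of a small coordinate ball can be pushed to each other in both directions, so \<open>strict_at\<close>
  is locally constant on the connected set \<open>B\<close>.
\<close>

lemma strict_at_domain:
  assumes B: "open B" "connected B" and W: "open W" "W \<noteq> {}" "W \<subseteq> B" and q: "q \<in> B"
  shows "strict_at W B q"
proof -
  obtain w where w: "w \<in> W" using W by blast
  have "strict_at W B w = strict_at W B q"
  proof (rule connected_local_const[OF B(2)])
    show "w \<in> B" "q \<in> B" using w W q by auto
    show "\<forall>a\<in>B. \<forall>\<^sub>F b in at a within B. strict_at W B a = strict_at W B b"
    proof
      fix a assume a: "a \<in> B"
      obtain c where c: "c \<in> A" "a \<in> fst c" using chart_exists by blast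
      obtain r where r: "r > 0" "cball (snd c a) r \<subseteq> snd c ` (fst c \<inter> B)"
        using open_chart_restrict[OF c(1) B(1)] a c(2) open_contains_cball by (metis IntI imageI)
      \<comment> \<open>half the radius, so that balls of radius \<open>r / 2\<close> centred in \<open>?U\<close> stay inside \<open>B\<close>\<close>
      let ?U = "{p \<in> fst c. snd c p \<in> ball (snd c a) (r / 2)}"
      have push: "strict_at W B q'" if "t \<in> fst c" "dist (snd c a) (snd c t) < r / 2"
          "q' \<in> fst c" "dist (snd c t) (snd c q') < r / 2" "strict_at W B t" for t q'
      proof (rule strict_at_push[OF W(1) c(1) that(1,5) _ that(3,4)])
        show "cball (snd c t) (r / 2) \<subseteq> snd c ` (fst c \<inter> B)"
        proof (rule order_trans[OF subsetI r(2)])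
          fix y assume "y \<in> cball (snd c t) (r / 2)"
          then show "y \<in> cball (snd c a) r"
            using that(2) dist_triangle[of "snd c a" y "snd c t"] by simp
        qed
      qed
      have "strict_at W B a = strict_at W B b" if "b \<in> ?U" for b
        using push[of a b] push[of b a] that c r(1) by (auto simp: dist_commute)
      moreover have "open ?U" by (rule open_chart_preimage[OF c(1) open_ball])
      moreover have "a \<in> ?U" using c r by simp
      ultimately show "\<forall>\<^sub>F b in at a within B. strict_at W B a = strict_at W B b"
        unfolding eventually_at_topological by blast
    qed
  qed
  then show ?thesis using w by (simp add: strict_at_def)
qed

end

theorem mainTheorem3:
  fixes A :: "('m::{t2_space, second_countable_topology}, 'n::finite) chart set"
    and g :: "'m metric_tensor"
    and B K W :: "'m set"
  assumes "riemannian_manifold A g"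
    and "open B" and "connected B"
    and "compact K" and "K \<subseteq> B"
    and "open W" and "W \<noteq> {}" and "W \<subseteq> B - K"
  shows "\<exists>\<alpha> :: 'm \<Rightarrow> real.
    smooth_fun A \<alpha> \<and>
    (\<forall>p. \<alpha> p \<ge> 0) \<and>
    (\<forall>p. p \<notin> B \<longrightarrow> \<alpha> p = 0) \<and>
    (\<forall>p\<in>K. \<alpha> p > 0 \<and> (\<forall>c\<in>A. p \<in> fst c \<longrightarrow> laplacian A g c \<alpha> p > 0)) \<and>
    (\<forall>p. p \<notin> W \<longrightarrow> (\<forall>c\<in>A. p \<in> fst c \<longrightarrow> laplacian A g c \<alpha> p \<ge> 0))"
proof -
  interpret riemannian A g
    by unfold_locales (rule assms(1))
  have "\<exists>\<alpha>. subharmonic_off W B \<alpha> \<and> \<alpha> q > 0 \<and> lap \<alpha> q > 0" if "q \<in> K" for q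
    using strict_at_domain[of B W q] assms that by (auto simp: strict_at_def)
  then obtain \<alpha> where \<alpha>: "\<And>q. q \<in> K \<Longrightarrow> subharmonic_off W B (\<alpha> q)"
      "\<And>q. q \<in> K \<Longrightarrow> \<alpha> q q > 0" "\<And>q. q \<in> K \<Longrightarrow> lap (\<alpha> q) q > 0"
    by metis
  define N where "N q = {p. 0 < \<alpha> q p} \<inter> {p. 0 < lap (\<alpha> q) p}" for q
  have "open (N q)" if "q \<in> K" for q
    unfolding N_def using \<alpha>(1)[OF that]
    by (intro open_Int open_Collect_less continuous_lap smooth_fun_continuous continuous_on_const)
       (auto simp: subharmonic_off_def)
  moreover have "K \<subseteq> (\<Union>q\<in>K. N q)"
    using \<alpha>(2,3) by (auto simp: N_def)
  ultimately obtain F where F: "F \<subseteq> K" "finite F" "K \<subseteq> (\<Union>q\<in>F. N q)"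
    using compactE_image[OF assms(4)] by metis
  let ?s = "\<lambda>p. \<Sum>q\<in>F. \<alpha> q p"
  have s: "subharmonic_off W B ?s" "\<And>p. lap ?s p = (\<Sum>q\<in>F. lap (\<alpha> q) p)"
    using subharmonic_off_sum[of F W B \<alpha>] F \<alpha>(1) by auto
  have "?s p > 0 \<and> lap ?s p > 0" if p: "p \<in> K" for p
  proof -
    obtain q where q: "q \<in> F" "p \<in> N q" using F p by blast
    have "p \<notin> W" using p assms(8) by blast
    then have "\<alpha> i p \<ge> 0 \<and> lap (\<alpha> i) p \<ge> 0" if "i \<in> F" for i
      using \<alpha>(1)[of i] F(1) that by (auto simp: subharmonic_off_def)
    then show ?thesis
      using q F(2) unfolding s(2) by (auto simp: N_def intro!: sum_pos2[of F q])
  qed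
  then show ?thesis
    using s(1) lap_eq[of _ _ ?s] by (intro exI[of _ ?s]) (auto simp: subharmonic_off_def)
qed

end
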